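(* Let $w$ be a weight on $\mathbb{D}$ with bounded hyperbolic oscillation. Then the following statements are equivalent: (i) For any $\lambda>0$, $w^\lambda\in B_2$. (ii) For any $\varepsilon>0$ there exists $h_\varepsilon\in L^\infty(\mathbb{D})$ such that $\|\log w-h_\varepsilon\|_{\mathrm{HLip}}<\varepsilon$. (iii) For any $\varepsilon>0$ there exists $h_\varepsilon\in L^\infty(\mathbb{D})$ such that $\|\log w-h_\varepsilon\|_{BMO(\mathbb{D})}<\varepsilon$. (iv) For any $\varepsilon>0$ there exists $C(\varepsilon)>0$ such that $$|\log w(z)-\log w(\zeta)|\le C(\varepsilon)+\varepsilon\,\beta(z,\zeta),\qquad z,\zeta\in\mathbb{D}.$$
   Context: $\mathbb{D}$ is the open unit disc, $\partial\mathbb{D}$ the unit circle, $m$ is Lebesgue measure on $\partial\mathbb{D}$, $dA$ is normalized Lebesgue area measure on $\mathbb{D}$. For an arc $I\subset\partial\mathbb{D}$ the associated Carleson square is $Q_I=\{z\in\mathbb{D}\setminus\{0\}: z/|z|\in I,\ 1-|z|<m(I)\}$. A weight is a positive integrable function on $\mathbb{D}$. A weight $w$ is a $B_2$-weight ($w\in B_2$) if $$[w]_{B_2}^2=\sup_I\Big(\frac1{A(Q_I)}\int_{Q_I}w\,dA\Big)\Big(\frac1{A(Q_I)}\int_{Q_I}w^{-1}\,dA\Big)<\infty,$$ the supremum being over all arcs $I\subset\partial\mathbb{D}$. The hyperbolic metric is $\beta(z,\zeta)=\frac12\log\frac{1+|\phi_z(\zeta)|}{1-|\phi_z(\zeta)|}$,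 where $\phi_z(\zeta)=\frac{z-\zeta}{1-\bar z\zeta}$, $z,\zeta\in\mathbb{D}$. A weight $w:\mathbb{D}\to(0,\infty)$ has bounded hyperbolic oscillation if there is a constant $C(w)>0$ with $|\log w(z)-\log w(\zeta)|\le C(w)(1+\beta(z,\zeta))$ for all $z,\zeta\in\mathbb{D}$. For a function $v$ on $\mathbb{D}$, $\|v\|_{\mathrm{HLip}}=\sup_{z\ne\zeta}\frac{|v(z)-v(\zeta)|}{\beta(z,\zeta)}$ (possibly $+\infty$). $L^\infty(\mathbb{D})$ is the space of essentially bounded real-valued functions on $\mathbb{D}$. For integrable real-valued $f$ on $\mathbb{D}$, $\|f\|_{BMO(\mathbb{D})}=\sup\frac1{A(D\cap\mathbb{D})}\int_{D\cap\mathbb{D}}|f-f_{D\cap\mathbb{D}}|\,dA$, the supremum being over all discs $D$ centered at points of $\mathbb{D}$, where $f_{D\cap\mathbb{D}}$ is the mean of $f$ over $D\cap\mathbb{D}$ with respect to $dA$. *)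

theory Defs
  imports "HOL-Analysis.Analysis"
begin

abbreviation unit_disc :: "complex set" where
  "unit_disc \<equiv> ball 0 1"

text \<open>Normalized so that the disc has measure 1. The underlying space is the disc itself, so
  measurability and integrability with respect to this measure do not depend on the values of a
  function outside the disc.\<close>

definition disc_area :: "complex measure" where
  "disc_area = density (lebesgue_on unit_disc) (\<lambda>_. ennreal (1 / pi))"

text \<open>Arc length measure, of total mass \<open>2 * pi\<close>.\<close>

definition circle_measure :: "complex measure" where
  "circle_measure =
     distr (restrict_space lborel {0..<2 * pi}) (restrict_space borel (sphere 0 1)) cis"

text \<open>An arc may contain either, both or none of its endpoints, and may be the whole circle.
  Empty and one-point arcs are left out, because their Carleson squares are empty and the averages
  over them are undefined.\<close>

definition circle_arc :: "complex set \<Rightarrow> bool" where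
  "circle_arc I \<longleftrightarrow>
     (\<exists>a b J. a < b \<and> b \<le> a + 2 * pi \<and> {a<..<b} \<subseteq> J \<and> J \<subseteq> {a..b} \<and> I = cis ` J)"

definition carleson_square :: "complex set \<Rightarrow> complex set" where
  "carleson_square I =
     {z \<in> unit_disc - {0}. z / of_real (norm z) \<in> I \<and> 1 - norm z < measure circle_measure I}"

definition weight :: "(complex \<Rightarrow> real) \<Rightarrow> bool" where
  "weight w \<longleftrightarrow> integrable disc_area w \<and> (\<forall>z\<in>unit_disc. 0 < w z)"

text \<open>The square of the characteristic \<open>[w]\<close>. The integrals are taken in \<^typ>\<open>ennreal\<close>, so a
  non-integrable \<open>1 / w\<close> contributes the value infinity.\<close>

definition B2_char_sq :: "(complex \<Rightarrow> real) \<Rightarrow> ennreal" where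
  "B2_char_sq w =
     (SUP I \<in> Collect circle_arc.
        ((\<integral>\<^sup>+z\<in>carleson_square I. ennreal (w z) \<partial>disc_area)
            / emeasure disc_area (carleson_square I)) *
        ((\<integral>\<^sup>+z\<in>carleson_square I. ennreal (1 / w z) \<partial>disc_area)
            / emeasure disc_area (carleson_square I)))"

definition B2_weight :: "(complex \<Rightarrow> real) \<Rightarrow> bool" where
  "B2_weight w \<longleftrightarrow> weight w \<and> B2_char_sq w < \<infinity>"

definition disc_moebius :: "complex \<Rightarrow> complex \<Rightarrow> complex" where
  "disc_moebius z \<zeta> = (z - \<zeta>) / (1 - cnj z * \<zeta>)"

definition hyp_dist :: "complex \<Rightarrow> complex \<Rightarrow> real" where
  "hyp_dist z \<zeta> = 1 / 2 * ln ((1 + norm (disc_moebius z \<zeta>)) / (1 - norm (disc_moebius z \<zeta>)))"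

definition bounded_hyperbolic_oscillation :: "(complex \<Rightarrow> real) \<Rightarrow> bool" where
  "bounded_hyperbolic_oscillation w \<longleftrightarrow>
     (\<exists>C>0. \<forall>z\<in>unit_disc. \<forall>\<zeta>\<in>unit_disc. \<bar>ln (w z) - ln (w \<zeta>)\<bar> \<le> C * (1 + hyp_dist z \<zeta>))"

definition hlip_norm :: "(complex \<Rightarrow> real) \<Rightarrow> ennreal" where
  "hlip_norm v =
     (SUP (z, \<zeta>) \<in> {(z, \<zeta>). z \<in> unit_disc \<and> \<zeta> \<in> unit_disc \<and> z \<noteq> \<zeta>}.
        ennreal (\<bar>v z - v \<zeta>\<bar> / hyp_dist z \<zeta>))"

definition Linfty_disc :: "(complex \<Rightarrow> real) set" where
  "Linfty_disc = {h \<in> borel_measurable disc_area. \<exists>M. AE z in disc_area. \<bar>h z\<bar> \<le> M}"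

definition disc_mean :: "(complex \<Rightarrow> real) \<Rightarrow> complex set \<Rightarrow> real" where
  "disc_mean f S = (\<integral>z\<in>S. f z \<partial>disc_area) / measure disc_area S"

text \<open>Non-integrable functions get norm infinity: the Bochner integral in \<^const>\<open>disc_mean\<close> is
  meaningful only for integrable ones.\<close>

definition bmo_norm :: "(complex \<Rightarrow> real) \<Rightarrow> ennreal" where
  "bmo_norm f =
     (if integrable disc_area f
      then (SUP (a, r) \<in> unit_disc \<times> {0<..}.
              (\<integral>\<^sup>+z\<in>ball a r \<inter> unit_disc.
                  ennreal \<bar>f z - disc_mean f (ball a r \<inter> unit_disc)\<bar> \<partial>disc_area)
                / emeasure disc_area (ball a r \<inter> unit_disc))
      else \<infinity>)"

end

(* Write u = log w. If u oscillates by at most C + eps * beta, then it differs by a bounded function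
   from inf_zeta (u(zeta) + eps * beta(z, zeta)), which is eps-Lipschitz for beta; this is
   (iv) => (ii). Over a Carleson square Q_I the mean of exp(beta(., c)) is bounded by an absolute
   constant if c is a suitable point of Q_I. Hence Lipschitz functions for beta have small mean
   oscillation, (ii) => (iii), and (iv) with eps = 1 / lambda bounds the means of w^lambda and
   w^(-lambda), (iv) => (i).

   Conversely the oscillation hypothesis makes u constant up to O(1) on the disc D_z of radius
   (1 - |z|) / 2 around z. For (i) => (iv), compare D_z and D_zeta with a Carleson square of size
   about |1 - conj(z) zeta| containing both: the loss is a power of
   |1 - conj(z) zeta|^2 / ((1 - |z|) (1 - |zeta|)), which is about exp(2 beta), to an exponent
   independent of lambda, so taking logarithms and dividing by lambda gives a small multiple of
   beta. For (iii) => (iv), u(z) is the mean of log w - h over D_z up to O(1); doubling the radius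
   changes the mean by O(eps), and O(1 + beta) doublings lead from D_z to a disc which also contains
   D_zeta. *)

theory Submission
  imports Defs
begin

subsection \<open>The hyperbolic metric\<close>

text \<open>Comparisons between two points use the scale d = |1 - cnj z \<zeta>|, which dominates
  both heights 1 - |z| and 1 - |\<zeta>| as well as |z - \<zeta>|. One Euclidean disc of radius
  proportional to d therefore holds both small discs, whether the points are hyperbolically close or
  far apart. The mean of exp beta over a square is bounded because exp beta(z, c) grows at most like
  the square root of m / (1 - |z|), with m the length of the arc, and this singularity is integrable
  in the plane up to the boundary. Means and suprema of means are integral quantities, blind to
  values at single points. The oscillation hypothesis is what converts them into statements about
  point values. In the direction towards Lipschitz approximation the difficulty is the opposite one:
  an infimum over uncountably many points has to be measurable, and it is so because it is
  continuous.\<close>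

lemma norm_moebius_identity:
  "(norm (1 - cnj z * \<zeta>))\<^sup>2 - (norm (z - \<zeta>))\<^sup>2 = (1 - (norm z)\<^sup>2) * (1 - (norm \<zeta>)\<^sup>2)"
  unfolding cmod_power2 by (simp add: power2_eq_square algebra_simps)

text \<open>Together with \<open>norm_diff_less_one_minus_cnj_mult\<close> this makes |1 - cnj z
  \<zeta>| a common scale for two points: it bounds their heights and their distance.\<close>

lemma norm_one_minus_cnj_mult_ge:
  assumes "norm z < 1" "norm \<zeta> < 1"
  shows "1 - norm z \<le> norm (1 - cnj z * \<zeta>)" "1 - norm \<zeta> \<le> norm (1 - cnj z * \<zeta>)"
proof -
  have "1 - norm z * norm \<zeta> \<le> norm (1 - cnj z * \<zeta>)"
    using norm_triangle_ineq2[of 1 "cnj z * \<zeta>"] by (simp add: norm_mult)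
  moreover have "norm z * norm \<zeta> \<le> norm z * 1" "norm z * norm \<zeta> \<le> 1 * norm \<zeta>"
    by (rule mult_mono; use assms in simp)+
  ultimately show "1 - norm z \<le> norm (1 - cnj z * \<zeta>)" "1 - norm \<zeta> \<le> norm (1 - cnj z * \<zeta>)"
    by auto
qed

lemma norm_one_minus_cnj_mult_less_2:
  assumes "norm z < 1" "norm \<zeta> < 1"
  shows "norm (1 - cnj z * \<zeta>) < 2"
proof -
  have "norm z * norm \<zeta> < 1"
    using mult_strict_mono'[of "norm z" 1 "norm \<zeta>" 1] assms by simp
  then show ?thesis
    using norm_triangle_ineq4[of 1 "cnj z * \<zeta>"] by (simp add: norm_mult)
qed

lemma norm_one_minus_cnj_mult_commute: "norm (1 - cnj \<zeta> * z) = norm (1 - cnj z * \<zeta>)"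
  by (metis complex_cnj_cnj complex_cnj_diff complex_cnj_mult complex_cnj_one complex_mod_cnj
      mult.commute)

lemma norm_diff_less_one_minus_cnj_mult:
  assumes "norm z < 1" "norm \<zeta> < 1"
  shows "norm (z - \<zeta>) < norm (1 - cnj z * \<zeta>)"
proof -
  have "0 < (1 - (norm z)\<^sup>2) * (1 - (norm \<zeta>)\<^sup>2)"
    using assms by (simp add: power_less_one_iff abs_square_less_1)
  then have "(norm (z - \<zeta>))\<^sup>2 < (norm (1 - cnj z * \<zeta>))\<^sup>2"
    using norm_moebius_identity[of z \<zeta>] by simp
  then show ?thesis
    by (rule power_less_imp_less_base) simp
qed

lemma norm_one_minus_cnj_mult_pos:
  assumes "norm z < 1" "norm \<zeta> < 1"
  shows "0 < norm (1 - cnj z * \<zeta>)"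
  using norm_diff_less_one_minus_cnj_mult[OF assms] norm_ge_zero[of "z - \<zeta>"] by linarith

lemma norm_disc_moebius: "norm (disc_moebius z \<zeta>) = norm (z - \<zeta>) / norm (1 - cnj z * \<zeta>)"
  by (simp add: disc_moebius_def norm_divide)

lemma norm_disc_moebius_less_1:
  assumes "norm z < 1" "norm \<zeta> < 1"
  shows "norm (disc_moebius z \<zeta>) < 1"
  using norm_diff_less_one_minus_cnj_mult[OF assms] norm_one_minus_cnj_mult_pos[OF assms]
  by (simp add: norm_disc_moebius)

lemma one_minus_norm_disc_moebius_sq:
  assumes "norm z < 1" "norm \<zeta> < 1"
  shows "1 - (norm (disc_moebius z \<zeta>))\<^sup>2 =
    (1 - (norm z)\<^sup>2) * (1 - (norm \<zeta>)\<^sup>2) / (norm (1 - cnj z * \<zeta>))\<^sup>2"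
  using norm_moebius_identity[of z \<zeta>] norm_one_minus_cnj_mult_pos[OF assms]
  by (simp add: norm_disc_moebius power_divide field_simps)

lemma exp_hyp_dist:
  assumes "norm z < 1" "norm \<zeta> < 1"
  shows "exp (2 * hyp_dist z \<zeta>) =
    (1 + norm (disc_moebius z \<zeta>)) / (1 - norm (disc_moebius z \<zeta>))"
proof -
  have "0 < (1 + norm (disc_moebius z \<zeta>)) / (1 - norm (disc_moebius z \<zeta>))"
    using norm_disc_moebius_less_1[OF assms]
    by (intro divide_pos_pos) (auto intro: add_pos_nonneg)
  then show ?thesis
    by (simp add: hyp_dist_def)
qed

lemma hyp_dist_commute: "hyp_dist \<zeta> z = hyp_dist z \<zeta>"
  by (simp add: hyp_dist_def norm_disc_moebius norm_minus_commute[of z]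
      norm_one_minus_cnj_mult_commute[of z])

lemma hyp_dist_refl [simp]: "hyp_dist z z = 0"
  by (simp add: hyp_dist_def norm_disc_moebius)

lemma hyp_dist_nonneg:
  assumes "norm z < 1" "norm \<zeta> < 1"
  shows "0 \<le> hyp_dist z \<zeta>"
  using norm_disc_moebius_less_1[OF assms] by (simp add: hyp_dist_def)

lemma hyp_dist_pos:
  assumes "norm z < 1" "norm \<zeta> < 1" "z \<noteq> \<zeta>"
  shows "0 < hyp_dist z \<zeta>"
proof -
  have "0 < norm (disc_moebius z \<zeta>)"
    using assms(3) norm_one_minus_cnj_mult_pos[OF assms(1,2)]
    by (simp add: norm_disc_moebius)
  then have "1 < (1 + norm (disc_moebius z \<zeta>)) / (1 - norm (disc_moebius z \<zeta>))"
    using norm_disc_moebius_less_1[OF assms(1,2)] by simp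
  then show ?thesis
    by (simp add: hyp_dist_def)
qed

text \<open>Multiplying (1 + \<rho>) / (1 - \<rho>) by 1 - \<rho>^2 leaves (1 + \<rho>)^2, which
  lies between 1 and 4.\<close>

lemma exp_hyp_dist_bounds:
  assumes "norm z < 1" "norm \<zeta> < 1"
  shows "(norm (1 - cnj z * \<zeta>))\<^sup>2 \<le>
      exp (2 * hyp_dist z \<zeta>) * ((1 - (norm z)\<^sup>2) * (1 - (norm \<zeta>)\<^sup>2))" (is ?lower)
    and "exp (2 * hyp_dist z \<zeta>) * ((1 - (norm z)\<^sup>2) * (1 - (norm \<zeta>)\<^sup>2)) \<le>
      4 * (norm (1 - cnj z * \<zeta>))\<^sup>2" (is ?upper)
proof -
  define \<rho> where "\<rho> = norm (disc_moebius z \<zeta>)"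
  define d where "d = (norm (1 - cnj z * \<zeta>))\<^sup>2"
  have \<rho>: "0 \<le> \<rho>" "\<rho> < 1"
    using norm_disc_moebius_less_1[OF assms] by (auto simp: \<rho>_def)
  have d: "0 < d"
    using norm_one_minus_cnj_mult_pos[OF assms] unfolding d_def by (rule zero_less_power)
  have "(1 - (norm z)\<^sup>2) * (1 - (norm \<zeta>)\<^sup>2) = (1 - \<rho>\<^sup>2) * d"
    using one_minus_norm_disc_moebius_sq[OF assms] d by (simp add: \<rho>_def d_def field_simps)
  moreover have "exp (2 * hyp_dist z \<zeta>) = (1 + \<rho>) / (1 - \<rho>)"
    by (simp add: exp_hyp_dist[OF assms] \<rho>_def)
  moreover have "(1 + \<rho>) / (1 - \<rho>) * ((1 - \<rho>\<^sup>2) * d) = (1 + \<rho>)\<^sup>2 * d"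
    using \<rho> by (simp add: field_simps power2_eq_square)
  ultimately have eq: "exp (2 * hyp_dist z \<zeta>) * ((1 - (norm z)\<^sup>2) * (1 - (norm \<zeta>)\<^sup>2)) =
      (1 + \<rho>)\<^sup>2 * d"
    by simp
  have "1 \<le> (1 + \<rho>)\<^sup>2"
    using \<rho> by simp
  moreover have "(1 + \<rho>)\<^sup>2 \<le> 2\<^sup>2"
    using \<rho> by (intro power_mono) auto
  ultimately show ?lower ?upper
    using d by (auto simp: eq simp flip: d_def)
qed

lemma norm_one_minus_cnj_mult_sq_le:
  assumes "norm z < 1" "norm \<zeta> < 1"
  shows "(norm (1 - cnj z * \<zeta>))\<^sup>2 \<le>
    4 * exp (2 * hyp_dist z \<zeta>) * ((1 - norm z) * (1 - norm \<zeta>))"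
proof -
  have le: "1 - x\<^sup>2 \<le> 2 * (1 - x)" for x :: real
    using zero_le_power2[of "1 - x"] by (simp add: power2_eq_square algebra_simps)
  have "(1 - (norm z)\<^sup>2) * (1 - (norm \<zeta>)\<^sup>2) \<le> (2 * (1 - norm z)) * (2 * (1 - norm \<zeta>))"
    using assms by (intro mult_mono le) (auto simp: power_le_one)
  also have "\<dots> = 4 * ((1 - norm z) * (1 - norm \<zeta>))"
    by (simp add: algebra_simps)
  finally have le4: "(1 - (norm z)\<^sup>2) * (1 - (norm \<zeta>)\<^sup>2) \<le> 4 * ((1 - norm z) * (1 - norm \<zeta>))" .
  note exp_hyp_dist_bounds(1)[OF assms]
  also have "exp (2 * hyp_dist z \<zeta>) * ((1 - (norm z)\<^sup>2) * (1 - (norm \<zeta>)\<^sup>2)) \<le>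
      exp (2 * hyp_dist z \<zeta>) * (4 * ((1 - norm z) * (1 - norm \<zeta>)))"
    using le4 by (rule mult_left_mono) simp
  finally show ?thesis
    by (simp only: mult_ac)
qed

text \<open>As \<open>hyp_dist\<close> is artanh of the pseudohyperbolic distance, the claim amounts
  to c <= (a + b) / (1 + a b), the addition formula of tanh. It is proved directly, without the
  invariance of the metric under disc automorphisms.\<close>

lemma hyp_dist_triangle:
  assumes "norm x < 1" "norm y < 1" "norm z < 1"
  shows "hyp_dist x z \<le> hyp_dist x y + hyp_dist y z"
proof -
  define a b c where "a = norm (disc_moebius x y)" and "b = norm (disc_moebius y z)"
    and "c = norm (disc_moebius x z)"
  note bounds = norm_disc_moebius_less_1
  have a: "0 \<le> a" "a < 1" and b: "0 \<le> b" "b < 1" and c: "0 \<le> c" "c < 1"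
    using assms bounds by (auto simp: a_def b_def c_def)
  define X Y Z where "X = 1 - (norm x)\<^sup>2" and "Y = 1 - (norm y)\<^sup>2" and "Z = 1 - (norm z)\<^sup>2"
  have pos: "0 < X" "0 < Y" "0 < Z"
    using assms by (auto simp: X_def Y_def Z_def power_less_one_iff abs_square_less_1)
  define p q r where "p = norm (1 - cnj x * y)" and "q = norm (1 - cnj y * z)"
    and "r = norm (1 - cnj x * z)"
  have pqr: "0 < p" "0 < q" "0 < r"
    using assms norm_one_minus_cnj_mult_pos by (auto simp: p_def q_def r_def)
  have sq: "1 - a\<^sup>2 = X * Y / p\<^sup>2" "1 - b\<^sup>2 = Y * Z / q\<^sup>2" "1 - c\<^sup>2 = X * Z / r\<^sup>2"
    using assms by (simp_all add: a_def b_def c_def X_def Y_def Z_def p_def q_def r_def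
        one_minus_norm_disc_moebius_sq)
  \<comment> \<open>This identity plays the role of moving y to the origin: dividing its norms by p
    q bounds r Y / (p q) by 1 + a b.\<close>
  have "(1 - cnj x * z) * (1 - y * cnj y) =
      (1 - cnj x * y) * (1 - cnj y * z) + (cnj x - cnj y) * (y - z)"
    by (simp add: algebra_simps)
  then have "norm ((1 - cnj x * z) * (1 - y * cnj y)) \<le>
      norm ((1 - cnj x * y) * (1 - cnj y * z)) + norm ((cnj x - cnj y) * (y - z))"
    using norm_triangle_ineq by metis
  moreover have "norm (1 - y * cnj y) = Y"
  proof -
    have "1 - y * cnj y = of_real Y"
      by (simp add: Y_def complex_norm_square[symmetric])
    then show ?thesis
      using pos by simp
  qed
  moreover have "norm (cnj x - cnj y) = a * p"
    using pqr by (simp add: a_def p_def norm_disc_moebius flip: complex_cnj_diff)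
  moreover have "norm (y - z) = b * q"
    using pqr by (simp add: b_def q_def norm_disc_moebius)
  ultimately have "r * Y \<le> p * q + (a * p) * (b * q)"
    unfolding norm_mult p_def[symmetric] q_def[symmetric] r_def[symmetric] by simp
  also have "\<dots> = p * q * (1 + a * b)"
    by (simp add: algebra_simps)
  finally have "r * Y \<le> p * q * (1 + a * b)" .
  then have "(r * Y)\<^sup>2 \<le> (p * q * (1 + a * b))\<^sup>2"
    using pqr pos by (intro power_mono) auto
  \<comment> \<open>The common factor is chosen so that, by \<open>sq\<close>, both sides depend on
    a, b and c alone.\<close>
  then have "(r * Y)\<^sup>2 * (X * Z / (p * q * r)\<^sup>2) \<le>
      (p * q * (1 + a * b))\<^sup>2 * (X * Z / (p * q * r)\<^sup>2)"
    using pos by (intro mult_right_mono) auto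
  moreover have "(r * Y)\<^sup>2 * (X * Z / (p * q * r)\<^sup>2) = (1 - a\<^sup>2) * (1 - b\<^sup>2)"
    unfolding sq using pqr by (simp add: field_simps power2_eq_square)
  moreover have "(p * q * (1 + a * b))\<^sup>2 * (X * Z / (p * q * r)\<^sup>2) =
      (1 + a * b)\<^sup>2 * (1 - c\<^sup>2)"
    unfolding sq power_mult_distrib using pqr by (simp add: field_simps)
  ultimately have "(1 - a\<^sup>2) * (1 - b\<^sup>2) \<le> (1 + a * b)\<^sup>2 * (1 - c\<^sup>2)"
    by simp
  moreover have "(1 - a\<^sup>2) * (1 - b\<^sup>2) = (1 + a * b)\<^sup>2 - (a + b)\<^sup>2"
    by (simp add: power2_eq_square algebra_simps)
  ultimately have "(c * (1 + a * b))\<^sup>2 \<le> (a + b)\<^sup>2"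
    by (simp add: power2_eq_square algebra_simps)
  then have "c * (1 + a * b) \<le> a + b"
    using a b by (simp add: abs_le_square_iff[symmetric] power2_le_iff_abs_le)
  then have "(1 + c) * ((1 - a) * (1 - b)) \<le> (1 + a) * (1 + b) * (1 - c)"
    by (simp add: algebra_simps)
  then have "(1 + c) / (1 - c) \<le> (1 + a) / (1 - a) * ((1 + b) / (1 - b))"
    using a b c by (simp add: divide_simps)
  then have "exp (2 * hyp_dist x z) \<le> exp (2 * hyp_dist x y) * exp (2 * hyp_dist y z)"
    using assms by (simp add: exp_hyp_dist a_def b_def c_def)
  then show ?thesis
    by (simp flip: exp_add)
qed

section \<open>Euclidean discs of bounded hyperbolic radius\<close>

lemma ball_half_subset_unit_disc:
  assumes "norm z < 1"
  shows "ball z ((1 - norm z) / 2) \<subseteq> unit_disc"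
proof
  fix \<xi> assume "\<xi> \<in> ball z ((1 - norm z) / 2)"
  then have "norm (\<xi> - z) < (1 - norm z) / 2"
    by (simp add: dist_norm norm_minus_commute)
  then show "\<xi> \<in> unit_disc"
    using norm_triangle_ineq2[of \<xi> z] assms by simp
qed

text \<open>The pseudohyperbolic distance is at most 1/2 here, so exp (2 beta) is at most 3, and 3
  <= exp 2. On such discs an oscillation bound C (1 + beta) costs only 2 C.\<close>

lemma hyp_dist_ball_half_le_1:
  assumes "norm z < 1" "\<xi> \<in> ball z ((1 - norm z) / 2)"
  shows "hyp_dist z \<xi> \<le> 1"
proof -
  have \<xi>: "norm \<xi> < 1"
    using assms ball_half_subset_unit_disc by fastforce
  define \<rho> where "\<rho> = norm (disc_moebius z \<xi>)"
  have "norm (z - \<xi>) \<le> 1 / 2 * norm (1 - cnj z * \<xi>)"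
    using norm_one_minus_cnj_mult_ge(1)[OF assms(1) \<xi>] assms(2) by (simp add: dist_norm)
  then have "\<rho> \<le> 1 / 2"
    using norm_one_minus_cnj_mult_pos[OF assms(1) \<xi>]
    by (simp add: \<rho>_def norm_disc_moebius field_simps)
  then have "(1 + \<rho>) / (1 - \<rho>) \<le> 3"
    by (simp add: field_simps)
  also have "3 \<le> exp (2 :: real)"
    using exp_ge_add_one_self[of "2 :: real"] by simp
  finally have "exp (2 * hyp_dist z \<xi>) \<le> exp (2 * 1)"
    using exp_hyp_dist[OF assms(1) \<xi>] by (simp add: \<rho>_def)
  then show ?thesis
    by (subst (asm) exp_le_cancel_iff) simp
qed

subsection \<open>Area and polar coordinates\<close>

lemma space_disc_area [simp]: "space disc_area = unit_disc"
  by (simp add: disc_area_def space_restrict_space)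

lemma sets_disc_area_iff: "S \<in> sets disc_area \<longleftrightarrow> S \<in> sets lebesgue \<and> S \<subseteq> unit_disc"
  by (auto simp: disc_area_def sets_restrict_space_iff)

lemma borel_subset_in_sets_disc_area: "S \<in> sets borel \<Longrightarrow> S \<subseteq> unit_disc \<Longrightarrow> S \<in> sets disc_area"
  by (simp add: sets_disc_area_iff)

lemma emeasure_disc_area:
  assumes "S \<in> sets disc_area"
  shows "emeasure disc_area S = ennreal (measure lebesgue S / pi)"
proof -
  have S: "S \<in> sets lebesgue" "S \<subseteq> unit_disc"
    using assms by (auto simp: sets_disc_area_iff)
  have "S \<in> lmeasurable"
    using S bounded_subset[OF bounded_ball S(2)] bounded_set_imp_lmeasurable by blast
  then have "emeasure lebesgue S = ennreal (measure lebesgue S)"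
    by (rule emeasure_eq_measure2)
  moreover have "emeasure disc_area S = ennreal (1 / pi) * emeasure (lebesgue_on unit_disc) S"
    unfolding disc_area_def by (rule emeasure_density_const)
      (use S in \<open>auto simp: sets_restrict_space_iff\<close>)
  moreover have "emeasure (lebesgue_on unit_disc) S = emeasure lebesgue S"
    using S by (intro emeasure_restrict_space) auto
  ultimately show ?thesis
    by (simp add: ennreal_mult''[symmetric] divide_inverse mult.commute)
qed

lemma measure_lborel_complex_ball: "0 \<le> r \<Longrightarrow> measure lborel (ball z r :: complex set) = pi * r\<^sup>2"
  using content_ball[of r z] by (simp add: unit_ball_vol_2)

lemma emeasure_disc_area_ball:
  assumes "ball z r \<subseteq> unit_disc" "0 \<le> r"
  shows "emeasure disc_area (ball z r) = ennreal (r\<^sup>2)"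
proof -
  have "ball z r \<in> sets disc_area"
    using assms by (intro borel_subset_in_sets_disc_area) auto
  then show ?thesis
    using assms by (simp add: emeasure_disc_area measure_lborel_complex_ball)
qed

lemma emeasure_disc_area_unit_disc [simp]: "emeasure disc_area unit_disc = 1"
  using emeasure_disc_area_ball[of 0 1] by simp

lemma finite_measure_disc_area: "finite_measure disc_area"
  by (rule finite_measureI) simp

lemma emeasure_disc_area_eq_measure: "emeasure disc_area S = ennreal (measure disc_area S)"
  by (rule finite_measure.emeasure_eq_measure[OF finite_measure_disc_area])

lemma emeasure_disc_area_le_ball:
  assumes "S \<in> sets disc_area" "S \<subseteq> ball z r" "0 \<le> r"
  shows "emeasure disc_area S \<le> ennreal (r\<^sup>2)"
proof -
  have "measure lebesgue S \<le> measure lebesgue (ball z r)"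
    using assms by (intro measure_mono_fmeasurable) (auto simp: sets_disc_area_iff)
  then have "measure lebesgue S / pi \<le> r\<^sup>2"
    using assms by (simp add: measure_lborel_complex_ball field_simps)
  then show ?thesis
    using assms by (simp add: emeasure_disc_area ennreal_leI)
qed

lemma emeasure_disc_area_singleton: "norm z < 1 \<Longrightarrow> emeasure disc_area {z} = 0"
  by (subst emeasure_disc_area) (auto intro!: borel_subset_in_sets_disc_area)

lemma continuous_on_imp_measurable_disc_area:
  fixes f :: "complex \<Rightarrow> 'b :: topological_space"
  assumes "continuous_on unit_disc f"
  shows "f \<in> borel_measurable disc_area"
proof -
  have "f \<in> borel_measurable (lebesgue_on unit_disc)"
    using assms by (intro continuous_imp_measurable_on_sets_lebesgue) auto
  then show ?thesis
    by (simp add: disc_area_def)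
qed

lemma ball_Int_unit_disc_in_sets: "ball a r \<inter> unit_disc \<in> sets disc_area"
  by (intro borel_subset_in_sets_disc_area) auto

text \<open>Moving the centre by r / 2 towards the origin, or to the origin itself if that is
  nearer, leaves room for a full disc of radius r / 2 inside the intersection. The second case uses
  r <= 2.\<close>

lemma emeasure_disc_area_ball_Int_ge:
  assumes "norm a < 1" "0 < r" "r \<le> 2"
  shows "ennreal (r\<^sup>2 / 4) \<le> emeasure disc_area (ball a r \<inter> unit_disc)"
proof -
  obtain c where c: "ball c (r / 2) \<subseteq> ball a r" "ball c (r / 2) \<subseteq> unit_disc"
  proof (cases "r / 2 \<le> norm a")
    case True
    define c where "c = (1 - r / (2 * norm a)) *\<^sub>R a"
    have a: "0 < norm a"
      using True assms by linarith
    have "a - c = (r / (2 * norm a)) *\<^sub>R a"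
      by (simp add: c_def scaleR_left_diff_distrib)
    then have "dist c a = r / 2"
      using a assms by (simp add: dist_norm norm_minus_commute)
    moreover have "norm c = norm a - r / 2"
      using True a assms by (simp add: c_def field_simps)
    ultimately show ?thesis
      using assms by (intro that[of c]) (auto simp: ball_subset_ball_iff dist_commute)
  next
    case False
    then show ?thesis
      using assms by (intro that[of 0]) (auto simp: ball_subset_ball_iff)
  qed
  then have "emeasure disc_area (ball c (r / 2)) \<le> emeasure disc_area (ball a r \<inter> unit_disc)"
    by (intro emeasure_mono) (auto intro: ball_Int_unit_disc_in_sets)
  moreover have "emeasure disc_area (ball c (r / 2)) = ennreal (r\<^sup>2 / 4)"
    using c assms by (subst emeasure_disc_area_ball) (auto simp: power_divide)
  ultimately show ?thesis
    by simp
qed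

section \<open>Chords and angles\<close>

lemma norm_cis_diff_le: "norm (cis a - cis b) \<le> \<bar>a - b\<bar>"
proof -
  have "cis a - cis b = cis b * (cis (a - b) - 1)"
    by (simp add: cis_mult algebra_simps)
  then have "norm (cis a - cis b) = norm (exp (\<i> * of_real (a - b)) - 1)"
    by (simp add: norm_mult cis_conv_exp)
  also have "\<dots> = 2 * \<bar>sin ((a - b) / 2)\<bar>"
    by (rule dist_exp_i_1)
  also have "\<dots> \<le> \<bar>a - b\<bar>"
    using abs_sin_x_le_abs_x[of "(a - b) / 2"] by simp
  finally show ?thesis .
qed

lemma abs_Arg_le:
  assumes "0 < Re w"
  shows "\<bar>Arg w\<bar> \<le> \<bar>Im w\<bar> / Re w"
proof -
  have "\<bar>Arg w\<bar> < pi / 2"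
    using assms Arg_Re_pos by blast
  then have "\<bar>Arg w\<bar> \<le> \<bar>tan (Arg w)\<bar>"
    by (rule abs_tan_ge)
  also have "tan (Arg w) = Im w / Re w"
  proof -
    have "Re w = norm w * cos (Arg w)" "Im w = norm w * sin (Arg w)"
      using arg_cong[OF rcis_cmod_Arg[of w], of Re] arg_cong[OF rcis_cmod_Arg[of w], of Im]
      by simp_all
    moreover have "norm w \<noteq> 0"
      using assms by auto
    ultimately show ?thesis
      by (metis mult_divide_mult_cancel_left tan_def)
  qed
  finally show ?thesis
    using assms by simp
qed

text \<open>After rotation by -\<alpha> the centre is r on the positive axis, so |Im| < s and Re > r
  - s on the disc, and an angle is at most its tangent. The angle \<theta> is not reduced to a fixed
  period, so it can be compared with the real endpoints of an arc around \<alpha>.\<close>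

lemma polar_near:
  assumes "\<xi> \<in> ball (of_real r * cis \<alpha>) s" "s < r"
  shows "\<exists>\<theta>. \<xi> = of_real (norm \<xi>) * cis \<theta> \<and> \<bar>\<theta> - \<alpha>\<bar> < s / (r - s)"
proof -
  define w where "w = \<xi> * cis (- \<alpha>)"
  have \<xi>: "\<xi> = w * cis \<alpha>"
    by (simp add: w_def cis_mult)
  then have "\<xi> - of_real r * cis \<alpha> = (w - of_real r) * cis \<alpha>"
    by (simp add: algebra_simps)
  then have w: "norm (w - of_real r) < s"
    using assms(1) by (simp add: dist_norm norm_minus_commute norm_mult)
  have Im: "\<bar>Im w\<bar> < s"
    using abs_Im_le_cmod[of "w - of_real r"] w by simp
  have Re: "r - s < Re w"
    using abs_Re_le_cmod[of "w - of_real r"] w by (simp add: abs_le_iff)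
  have "\<bar>Arg w\<bar> \<le> \<bar>Im w\<bar> / Re w"
    using Re assms by (intro abs_Arg_le) simp
  also have "\<dots> < s / (r - s)"
    using Im Re assms by (intro frac_less) auto
  finally have "\<bar>Arg w\<bar> < s / (r - s)" .
  moreover have "\<xi> = of_real (norm \<xi>) * cis (Arg w + \<alpha>)"
  proof -
    have "w = of_real (norm w) * cis (Arg w)"
      using rcis_cmod_Arg[of w] by (simp add: rcis_def)
    then show ?thesis
      by (metis \<xi> cis_mult mult.assoc mult.right_neutral norm_cis norm_mult)
  qed
  ultimately show ?thesis
    by (intro exI[of _ "Arg w + \<alpha>"]) simp
qed

subsection \<open>Arcs and Carleson squares\<close>

text \<open>The open interval is a countable union of compact sets, whose images are compact; at
  most two endpoints remain. The argument works even if \<open>cis\<close> is not injective on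
  J.\<close>

lemma cis_image_interval_in_sets_borel:
  assumes "{a<..<b} \<subseteq> J" "J \<subseteq> {a..b}"
  shows "cis ` J \<in> sets borel"
proof -
  have "open {a<..<b}"
    by simp
  then obtain C :: "nat \<Rightarrow> real set" where C: "\<And>n. compact (C n)" "\<Union> (range C) = {a<..<b}"
    using open_Union_compact_subsets by metis
  have "cis ` C n \<in> sets borel" for n
    using C by (intro borel_compact compact_continuous_image continuous_intros)
  then have "(\<Union>n. cis ` C n) \<in> sets borel"
    by (intro sets.countable_UN image_subsetI)
  moreover have "finite (cis ` (J - {a<..<b}))"
    using assms by (intro finite_imageI, rule_tac finite_subset[of _ "{a, b}"]) auto
  then have "cis ` (J - {a<..<b}) \<in> sets borel"
    by (intro borel_closed finite_imp_closed)
  moreover have "cis ` J = (\<Union>n. cis ` C n) \<union> cis ` (J - {a<..<b})"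
  proof -
    have "J = \<Union> (range C) \<union> (J - {a<..<b})"
      using assms C(2) by auto
    then show ?thesis
      by (metis image_Un image_UN)
  qed
  ultimately show ?thesis
    by simp
qed

text \<open>An arc that starts in [0, 2 pi) may run past 2 pi. Its preimage then consists of a piece
  from a to m and a wrapped piece from 0 to l. Closed intervals bound it from above and open ones
  from below, so it is irrelevant which endpoints J contains.\<close>

lemma measure_circle_measure_arc_aux:
  assumes J: "{a<..<b} \<subseteq> J" "J \<subseteq> {a..b}" and ab: "a < b" "b \<le> a + 2 * pi"
    and a: "0 \<le> a" "a < 2 * pi"
  shows "measure circle_measure (cis ` J) = b - a"
proof -
  define P where "P = cis -` cis ` J \<inter> {0..<2 * pi}"
  define m where "m = min b (2 * pi)"
  define l where "l = max (b - 2 * pi) 0"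
  have ml: "a < m" "0 \<le> l" "l \<le> a" "m - a + l = b - a"
    using ab a by (auto simp: m_def l_def)
  have borel: "cis ` J \<in> sets borel"
    by (rule cis_image_interval_in_sets_borel[OF J])
  have meas: "cis \<in> measurable (restrict_space lborel {0..<2 * pi})
      (restrict_space borel (sphere 0 1))"
    by (intro measurable_restrict_space2 measurable_restrict_space1)
      (auto simp: borel_measurable_continuous_onI continuous_intros)
  have P: "P \<in> sets lborel"
    unfolding P_def
    using measurable_sets[OF borel_measurable_continuous_onI[of cis] borel]
    by (auto simp: continuous_intros)
  have Icc: "{x..y} \<in> fmeasurable lborel" for x y :: real
    by (intro fmeasurableI) (auto simp: emeasure_lborel_Icc_eq)
  have "measure circle_measure (cis ` J) = measure (restrict_space lborel {0..<2 * pi}) P"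
    unfolding circle_measure_def P_def
    by (subst measure_distr[OF meas])
      (use borel in \<open>auto simp: space_restrict_space sets_restrict_space_iff\<close>)
  also have "\<dots> = measure lborel P"
    by (rule measure_restrict_space) (auto simp: P_def)
  also have "\<dots> = b - a"
  proof (rule antisym)
    have "P \<subseteq> {a..m} \<union> {0..l}"
    proof
      fix \<theta> assume "\<theta> \<in> P"
      then obtain \<phi> where \<theta>: "0 \<le> \<theta>" "\<theta> < 2 * pi" and \<phi>: "\<phi> \<in> J" "cis \<theta> = cis \<phi>"
        by (auto simp: P_def)
      then have "sin \<theta> = sin \<phi> \<and> cos \<theta> = cos \<phi>"
        by (simp add: complex_eq_iff)
      then obtain n :: int where n: "\<theta> = \<phi> + 2 * pi * n"
        using sin_cos_eq_iff by (auto simp: mult_ac)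
      have \<phi>': "a \<le> \<phi>" "\<phi> \<le> b"
        using \<phi> J by auto
      \<comment> \<open>\<theta> lies in [0, 2 pi) and \<phi> in [0, 4 pi), so they differ by no
        turn or by one turn backwards.\<close>
      have "n < 1"
      proof (rule ccontr)
        assume "\<not> n < 1"
        then have "2 * pi * 1 \<le> 2 * pi * n"
          by (intro mult_left_mono) auto
        then show False
          using n \<theta> \<phi>' a by linarith
      qed
      moreover have "- 2 < n"
      proof (rule ccontr)
        assume "\<not> - 2 < n"
        then have "2 * pi * n \<le> 2 * pi * (- 2)"
          by (intro mult_left_mono) auto
        then show False
          using n \<theta> \<phi>' a ab by linarith
      qed
      ultimately have "n = 0 \<or> n = - 1"
        by linarith
      then show "\<theta> \<in> {a..m} \<union> {0..l}"
        using n \<theta> \<phi>' by (auto simp: m_def l_def)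
    qed
    then have "measure lborel P \<le> measure lborel ({a..m} \<union> {0..l})"
      by (intro measure_mono_fmeasurable P fmeasurable.Un Icc)
    also have "\<dots> \<le> measure lborel {a..m} + measure lborel {0..l}"
      by (intro measure_Un_le) auto
    finally show "measure lborel P \<le> b - a"
      using ml by simp
  next
    have "{a<..<m} \<union> {0<..<l} \<subseteq> P"
    proof
      fix \<theta> assume "\<theta> \<in> {a<..<m} \<union> {0<..<l}"
      then consider "a < \<theta>" "\<theta> < m" | "0 < \<theta>" "\<theta> < l"
        by auto
      then show "\<theta> \<in> P"
      proof cases
        case 1
        then show ?thesis
          using J a by (auto simp: P_def m_def)
      next
        case 2
        then have "\<theta> + 2 * pi \<in> J" "\<theta> < 2 * pi"
          using J a ab by (auto simp: l_def)
        moreover have "cis \<theta> = cis (\<theta> + 2 * pi)"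
          by (simp add: cis_mult[symmetric])
        ultimately show ?thesis
          using 2 by (auto simp: P_def)
      qed
    qed
    then have "measure lborel ({a<..<m} \<union> {0<..<l}) \<le> measure lborel P"
      by (intro measure_mono_fmeasurable fmeasurableI2[OF Icc[of 0 "2 * pi"]] P)
        (auto simp: P_def)
    moreover have "measure lborel ({a<..<m} \<union> {0<..<l}) =
        measure lborel {a<..<m} + measure lborel {0<..<l}"
      by (rule measure_Union) (use ml in \<open>auto simp: emeasure_lborel_Ioo\<close>)
    ultimately show "b - a \<le> measure lborel P"
      using ml by simp
  qed
  finally show ?thesis .
qed

lemma measure_circle_measure_arc:
  assumes J: "{a<..<b} \<subseteq> J" "J \<subseteq> {a..b}" and ab: "a < b" "b \<le> a + 2 * pi"
  shows "measure circle_measure (cis ` J) = b - a"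
proof -
  define k where "k = \<lfloor>a / (2 * pi)\<rfloor>"
  define c where "c = 2 * pi * real_of_int k"
  have "real_of_int k \<le> a / (2 * pi)" "a / (2 * pi) < real_of_int k + 1"
    by (auto simp: k_def)
  then have c: "0 \<le> a - c" "a - c < 2 * pi"
    by (auto simp: c_def field_simps)
  have "cis (\<theta> - c) = cis \<theta>" for \<theta>
    using cis_multiple_2pi[of "of_int k"] by (simp add: c_def cis_divide[symmetric])
  then have "cis ` J = cis ` ((\<lambda>\<theta>. \<theta> - c) ` J)"
    by (simp add: image_image)
  also have "measure circle_measure \<dots> = (b - c) - (a - c)"
  proof (rule measure_circle_measure_arc_aux)
    show "{a - c<..<b - c} \<subseteq> (\<lambda>\<theta>. \<theta> - c) ` J"
    proof
      fix x assume "x \<in> {a - c<..<b - c}"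
      then have "x + c \<in> J"
        using J by auto
      then show "x \<in> (\<lambda>\<theta>. \<theta> - c) ` J"
        by (metis add_diff_cancel_right' imageI)
    qed
  qed (use J ab c in auto)
  finally show ?thesis
    by simp
qed

lemma carleson_square_arc:
  assumes "{a<..<b} \<subseteq> J" "J \<subseteq> {a..b}" "a < b" "b \<le> a + 2 * pi"
  shows "carleson_square (cis ` J) =
    {z \<in> unit_disc - {0}. z / of_real (norm z) \<in> cis ` J \<and> 1 - norm z < b - a}"
  by (simp add: carleson_square_def measure_circle_measure_arc[OF assms])

lemma carleson_square_in_sets:
  assumes "circle_arc I"
  shows "carleson_square I \<in> sets disc_area"
proof -
  obtain a b J where I: "{a<..<b} \<subseteq> J" "J \<subseteq> {a..b}" "I = cis ` J"
    using assms by (auto simp: circle_arc_def)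
  then have [measurable]: "I \<in> sets borel"
    using cis_image_interval_in_sets_borel by blast
  have "carleson_square I = {z \<in> space borel. norm z < 1 \<and> z \<noteq> 0 \<and>
      z / of_real (norm z) \<in> I \<and> 1 - norm z < measure circle_measure I}"
    by (auto simp: carleson_square_def)
  also have "\<dots> \<in> sets borel"
    by measurable
  finally show ?thesis
    by (rule borel_subset_in_sets_disc_area) (auto simp: carleson_square_def)
qed

lemma carleson_square_polar:
  assumes "{a<..<b} \<subseteq> J" "J \<subseteq> {a..b}" "a < b" "b \<le> a + 2 * pi"
    and "z \<in> carleson_square (cis ` J)"
  obtains \<theta> where "a \<le> \<theta>" "\<theta> \<le> b" "z = of_real (norm z) * cis \<theta>"
proof -
  obtain \<theta> where "\<theta> \<in> J" "z / of_real (norm z) = cis \<theta>" "z \<noteq> 0"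
    using assms(5) unfolding carleson_square_arc[OF assms(1-4)] by auto
  then show ?thesis
    using assms(2) that[of \<theta>] by (auto simp: field_simps)
qed

text \<open>The angle must lie strictly between a and b, because J may lack its endpoints.\<close>

lemma in_carleson_squareI:
  assumes "{a<..<b} \<subseteq> J" "J \<subseteq> {a..b}" "a < b" "b \<le> a + 2 * pi"
    and "norm z < 1" "z \<noteq> 0" "1 - norm z < b - a" "z = of_real (norm z) * cis \<theta>"
    "a < \<theta>" "\<theta> < b"
  shows "z \<in> carleson_square (cis ` J)"
proof -
  have "z / of_real (norm z) = cis \<theta>"
    using assms(6,8) by (metis nonzero_mult_div_cancel_left norm_eq_zero of_real_eq_0_iff)
  then show ?thesis
    using assms unfolding carleson_square_arc[OF assms(1-4)] by auto
qed

subsection \<open>Size of Carleson squares\<close>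

lemma circle_arc_cis_Icc: "a < b \<Longrightarrow> b \<le> a + 2 * pi \<Longrightarrow> circle_arc (cis ` {a..b})"
  unfolding circle_arc_def by (intro exI[of _ a] exI[of _ b] exI[of _ "{a..b}"]) auto

text \<open>The height condition is void since 2 pi exceeds 1. Integrals over the whole disc thereby
  become integrals over a Carleson square, up to the null set {0}.\<close>

lemma carleson_square_full: "carleson_square (cis ` {- pi..pi}) = unit_disc - {0}"
proof -
  have "z / of_real (norm z) \<in> cis ` {- pi..pi}" if "z \<noteq> 0" for z
  proof -
    have "z / of_real (norm z) = cis (Arg z)"
      using that by (simp add: cis_Arg sgn_eq)
    then show ?thesis
      using Arg_bounded[of z] by auto
  qed
  moreover have "1 - norm z < 2 * pi" for z :: complex
    using pi_gt3 norm_ge_zero[of z] by linarith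
  ultimately show ?thesis
    by (subst carleson_square_arc[of "- pi" pi]) auto
qed

text \<open>The radius 3 d / 2 leaves room for a disc of radius d / 2 about any point at distance
  less than d from z. For d <= 1/5 the ball stays at distance 1/2 from the origin, so angles deviate
  by less than 3 d and an arc of length 6 d suffices. For larger d the whole circle is short enough,
  as 2 pi < 8 < 40 d. The origin is removed because no Carleson square contains it.\<close>

lemma ball_subset_carleson_square:
  assumes "norm z < 1" "1 - norm z \<le> d"
  shows "\<exists>a b. a < b \<and> b \<le> a + 2 * pi \<and> b - a \<le> 40 * d \<and>
    ball z (3 * d / 2) \<inter> unit_disc - {0} \<subseteq> carleson_square (cis ` {a..b})"
proof (cases "d \<le> 1 / 5")
  case False
  have "2 * pi \<le> 40 * d"
    using False pi_less_4 by simp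
  then show ?thesis
    by (intro exI[of _ "- pi"] exI[of _ pi]) (auto simp: carleson_square_full)
next
  case True
  define \<alpha> where "\<alpha> = Arg z"
  have d: "0 < d"
    using assms by simp
  have z: "z = of_real (norm z) * cis \<alpha>"
    using rcis_cmod_Arg[of z] by (simp add: \<alpha>_def rcis_def)
  have "ball z (3 * d / 2) \<inter> unit_disc - {0} \<subseteq> carleson_square (cis ` {\<alpha> - 3 * d..\<alpha> + 3 * d})"
  proof
    fix \<xi> assume \<xi>: "\<xi> \<in> ball z (3 * d / 2) \<inter> unit_disc - {0}"
    have le: "1 / 2 \<le> norm z - 3 * d / 2"
      using assms True by linarith
    obtain \<theta> where \<theta>: "\<xi> = of_real (norm \<xi>) * cis \<theta>"
        "\<bar>\<theta> - \<alpha>\<bar> < (3 * d / 2) / (norm z - 3 * d / 2)"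
      using polar_near[of \<xi> "norm z" \<alpha> "3 * d / 2"] \<xi> z le by auto
    have "(3 * d / 2) / (norm z - 3 * d / 2) \<le> (3 * d / 2) / (1 / 2)"
      using le d by (intro divide_left_mono) auto
    then have "\<bar>\<theta> - \<alpha>\<bar> < 3 * d"
      using \<theta> by simp
    \<comment> \<open>Hence 1 - |\<xi>| < 5 d / 2, which is below the arc length 6 d.\<close>
    moreover have "norm z - norm \<xi> < 3 * d / 2"
      using norm_triangle_ineq2[of z \<xi>] \<xi> by (simp add: dist_norm)
    ultimately show "\<xi> \<in> carleson_square (cis ` {\<alpha> - 3 * d..\<alpha> + 3 * d})"
      using \<xi> \<theta> d assms True pi_gt3 by (intro in_carleson_squareI[where a = "\<alpha> - 3 * d" and b = "\<alpha> + 3 * d" and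
            \<theta> = \<theta>]) auto
  qed
  then show ?thesis
    using d True pi_gt3 by (intro exI[of _ "\<alpha> - 3 * d"] exI[of _ "\<alpha> + 3 * d"]) auto
qed

section \<open>Area of a square and its thin layers, and the integral of exp beta\<close>

context
  fixes a b m :: real and J :: "real set"
  assumes J: "{a<..<b} \<subseteq> J" "J \<subseteq> {a..b}" and ab: "a < b" "b \<le> a + 2 * pi"
  defines "m \<equiv> b - a"
begin

lemma carleson_square_sets: "carleson_square (cis ` J) \<in> sets disc_area"
  using J ab by (intro carleson_square_in_sets) (auto simp: circle_arc_def)

lemma arc_length_bounds: "0 < m" "m < 8"
  using ab pi_less_4 by (auto simp: m_def)

text \<open>A disc of radius m / 32 fits at height m / 16 below the midpoint of the arc. The
  fractions are this small because the arc may be the whole circle: m < 8 keeps the disc at distance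
  more than 1/4 from the origin, so its angles deviate by less than m / 8.\<close>

lemma emeasure_carleson_square_ge:
  "ennreal ((m / 32)\<^sup>2) \<le> emeasure disc_area (carleson_square (cis ` J))"
proof -
  note m = arc_length_bounds
  define c where "c = of_real (1 - m / 16) * cis ((a + b) / 2)"
  have norm_c: "norm c = 1 - m / 16"
    unfolding c_def norm_mult norm_of_real using m by simp
  have "ball c (m / 32) \<subseteq> carleson_square (cis ` J)"
  proof
    fix \<xi> assume \<xi>: "\<xi> \<in> ball c (m / 32)"
    then have "norm (c - \<xi>) < m / 32"
      by (simp add: dist_norm)
    then have "\<bar>norm \<xi> - norm c\<bar> < m / 32"
      using norm_triangle_ineq3[of \<xi> c] by (simp add: norm_minus_commute)
    then have norm_\<xi>: "norm \<xi> < 1" "1 - norm \<xi> < m" "0 < norm \<xi>"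
      using m by (auto simp: norm_c abs_if split: if_splits)
    obtain \<theta> where \<theta>: "\<xi> = of_real (norm \<xi>) * cis \<theta>"
        "\<bar>\<theta> - (a + b) / 2\<bar> < (m / 32) / (1 - m / 16 - m / 32)"
      using polar_near[of \<xi> "1 - m / 16" "(a + b) / 2" "m / 32"] \<xi> m by (auto simp: c_def)
    have "(m / 32) / (1 - m / 16 - m / 32) \<le> (m / 32) / (1 / 4)"
      using m by (intro divide_left_mono) auto
    also have "\<dots> < m / 2"
      using m by simp
    finally have "\<bar>\<theta> - (a + b) / 2\<bar> < m / 2"
      using \<theta>(2) by linarith
    then have "a < \<theta>" "\<theta> < b"
      by (auto simp: m_def abs_less_iff field_simps)
    then show "\<xi> \<in> carleson_square (cis ` J)"
      using norm_\<xi> \<theta> by (intro in_carleson_squareI[OF J ab]) (auto simp: m_def)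
  qed
  moreover have "carleson_square (cis ` J) \<subseteq> unit_disc"
    by (auto simp: carleson_square_def)
  moreover have "0 \<le> m / 32"
    using m by simp
  ultimately show ?thesis
    using emeasure_mono[OF _ carleson_square_sets] emeasure_disc_area_ball by (metis subset_trans)
qed

text \<open>The part of the square at height less than \<open>m / 4 ^ k\<close> is covered by \<open>4 ^ k\<close> balls of
  radius \<open>2 * (m / 4 ^ k)\<close> centred on the arc; this replaces polar coordinates.\<close>

lemma emeasure_carleson_layer_le:
  "emeasure disc_area {z \<in> carleson_square (cis ` J). 1 - norm z < m / 4 ^ k} \<le>
    ennreal (4 * m\<^sup>2 / 4 ^ k)"
proof -
  note m = arc_length_bounds
  define t where "t = m / 4 ^ k"
  have t: "0 < t" "4 ^ k * t = m"
    using m by (auto simp: t_def)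
  define c where "c j = cis (a + real j * t)" for j
  have cover: "{z \<in> carleson_square (cis ` J). 1 - norm z < t} \<subseteq>
      (\<Union>j<4 ^ k. ball (c j) (2 * t) \<inter> unit_disc)"
  proof
    fix z assume z: "z \<in> {z \<in> carleson_square (cis ` J). 1 - norm z < t}"
    then have z1: "norm z < 1"
      by (auto simp: carleson_square_def)
    obtain \<theta> where \<theta>: "a \<le> \<theta>" "\<theta> \<le> b" "z = of_real (norm z) * cis \<theta>"
      using z carleson_square_polar[OF J ab] by blast
    \<comment> \<open>The endpoint \<theta> = b is separate: rounding down would give the index 4 ^
      k, one too large.\<close>
    obtain j where j: "j < 4 ^ k" "\<bar>\<theta> - (a + real j * t)\<bar> \<le> t"
    proof (cases "\<theta> = b")
      case True
      have "real (4 ^ k - 1) * t = m - t"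
        using t by (simp add: of_nat_diff algebra_simps)
      then show ?thesis
        using True t by (intro that[of "4 ^ k - 1"]) (auto simp: m_def)
    next
      case False
      define j where "j = nat \<lfloor>(\<theta> - a) / t\<rfloor>"
      have "0 \<le> (\<theta> - a) / t"
        using \<theta> t by simp
      then have j: "real j \<le> (\<theta> - a) / t" "(\<theta> - a) / t < real j + 1"
        by (auto simp: j_def)
      have "(\<theta> - a) / t < 4 ^ k"
        using False \<theta> t by (simp add: pos_divide_less_eq m_def)
      then have "real j < 4 ^ k"
        using j by linarith
      then have "j < 4 ^ k"
        by simp
      then show ?thesis
        using j t by (intro that[of j]) (auto simp: field_simps abs_le_iff)
    qed
    have "z - c j = of_real (norm z - 1) * cis \<theta> + (cis \<theta> - c j)"
      using \<theta>(3) by (simp add: algebra_simps)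
    then have "norm (z - c j) \<le> norm (of_real (norm z - 1) * cis \<theta>) + norm (cis \<theta> - c j)"
      using norm_triangle_ineq by metis
    also have "norm (of_real (norm z - 1) * cis \<theta>) = 1 - norm z"
      using z1 unfolding norm_mult norm_of_real by simp
    also have "norm (cis \<theta> - c j) \<le> t"
      using norm_cis_diff_le[of \<theta> "a + real j * t"] j by (simp add: c_def)
    finally have "norm (z - c j) < 2 * t"
      using z by simp
    then show "z \<in> (\<Union>j<4 ^ k. ball (c j) (2 * t) \<inter> unit_disc)"
      using z1 j by (auto simp: dist_norm norm_minus_commute)
  qed
  have "emeasure disc_area {z \<in> carleson_square (cis ` J). 1 - norm z < t} \<le>
      emeasure disc_area (\<Union>j<4 ^ k. ball (c j) (2 * t) \<inter> unit_disc)"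
    using cover by (intro emeasure_mono) (auto intro!: borel_subset_in_sets_disc_area)
  also have "\<dots> \<le> (\<Sum>j<4 ^ k. emeasure disc_area (ball (c j) (2 * t) \<inter> unit_disc))"
    by (intro emeasure_subadditive_finite) (auto intro: ball_Int_unit_disc_in_sets)
  also have "\<dots> \<le> (\<Sum>j<(4 :: nat) ^ k. ennreal ((2 * t)\<^sup>2))"
    using t by (intro sum_mono emeasure_disc_area_le_ball) (auto intro: ball_Int_unit_disc_in_sets)
  also have "\<dots> = ennreal (\<Sum>j<(4 :: nat) ^ k. (2 * t)\<^sup>2)"
    by (rule sum_ennreal) simp
  also have "(\<Sum>j<(4 :: nat) ^ k. (2 * t)\<^sup>2) = 4 * m\<^sup>2 / 4 ^ k"
    by (simp add: t_def power2_eq_square)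
  finally show ?thesis
    by (simp add: t_def)
qed

lemma emeasure_carleson_square_le:
  "emeasure disc_area (carleson_square (cis ` J)) \<le> ennreal (4 * m\<^sup>2)"
proof -
  have "carleson_square (cis ` J) = {z \<in> carleson_square (cis ` J). 1 - norm z < m / 4 ^ 0}"
    by (auto simp: carleson_square_arc[OF J ab] m_def)
  then show ?thesis
    using emeasure_carleson_layer_le[of 0] by simp
qed

text \<open>At height x the quantity exp (2 beta(z, c)) is O(m / x), since |1 - cnj z c| <= 2 m
  while the heights of z and c are x and m / 16. On the layer x < m / 4 ^ k that is not in the next
  one, exp beta is thus at most 32 * 2 ^ k, whereas the layer has area at most 4 m^2 / 4 ^ k. The
  products form a geometric series with ratio 1/2 and sum 256 m^2.\<close>

lemma nn_integral_exp_hyp_dist_le: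
  obtains c where "norm c < 1"
    "(\<integral>\<^sup>+z\<in>carleson_square (cis ` J). ennreal (exp (hyp_dist z c)) \<partial>disc_area) \<le>
      ennreal (256 * m\<^sup>2)"
proof
  note m = arc_length_bounds
  define r \<alpha> c where "r = 1 - m / 16" and "\<alpha> = (a + b) / 2" and "c = of_real r * cis \<alpha>"
  have norm_c: "norm c = r"
    unfolding c_def norm_mult norm_of_real using m by (simp add: r_def)
  then show c: "norm c < 1"
    using m by (simp add: r_def)
  define L where "L k = {z \<in> carleson_square (cis ` J). 1 - norm z < m / 4 ^ k}" for k
  have L: "L k \<in> sets disc_area" for k
  proof -
    have "{z :: complex. 1 - norm z < m / 4 ^ k} \<in> sets borel"
      by measurable
    then have "{z. 1 - norm z < m / 4 ^ k} \<inter> unit_disc \<in> sets disc_area"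
      by (intro borel_subset_in_sets_disc_area) auto
    moreover have "L k = carleson_square (cis ` J) \<inter> ({z. 1 - norm z < m / 4 ^ k} \<inter> unit_disc)"
      by (auto simp: L_def carleson_square_def)
    ultimately show ?thesis
      using carleson_square_sets by auto
  qed
  have pointwise: "ennreal (exp (hyp_dist z c)) * indicator (carleson_square (cis ` J)) z \<le>
      (\<Sum>k. ennreal (32 * 2 ^ k) * indicator (L k) z)" for z
  proof (cases "z \<in> carleson_square (cis ` J)")
    case True
    define f where "f i = ennreal (32 * 2 ^ i) * indicator (L i) z" for i
    define x where "x = 1 - norm z"
    have z: "norm z < 1" and x: "0 < x" "x < m"
      using True by (auto simp: carleson_square_arc[OF J ab] m_def x_def)
    obtain n where "(1 / 4) ^ n < x / m"
      using real_arch_pow_inv[of "x / m" "1 / 4"] x m by auto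
    then have n: "m / 4 ^ n \<le> x"
      using m by (simp add: field_simps)
    \<comment> \<open>The deepest layer containing z has index k = N - 1; the height condition x < m
      excludes N = 0.\<close>
    define N where "N = (LEAST n. m / 4 ^ n \<le> x)"
    have N: "m / 4 ^ N \<le> x"
      unfolding N_def by (rule LeastI[of _ n]) (rule n)
    have "N \<noteq> 0"
      using N x by (intro notI) simp
    then obtain k where k: "N = Suc k"
      using not0_implies_Suc by blast
    have xk: "x < m / 4 ^ k"
      using not_less_Least[of k "\<lambda>n. m / 4 ^ n \<le> x"] k by (auto simp: N_def)
    obtain \<theta> where \<theta>: "a \<le> \<theta>" "\<theta> \<le> b" "z = of_real (norm z) * cis \<theta>"
      using True carleson_square_polar[OF J ab] by blast
    define p where "p = norm z * r"
    have r: "0 < r" "r < 1"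
      using m by (auto simp: r_def)
    have p: "0 \<le> p" "p \<le> 1" "1 - p \<le> x + m / 16"
    proof -
      show "0 \<le> p" "p \<le> 1"
        using r z mult_mono[of "norm z" 1 r 1] by (auto simp: p_def)
      have "0 \<le> (1 - norm z) * (1 - r)"
        using r z by simp
      then show "1 - p \<le> x + m / 16"
        by (simp add: p_def x_def algebra_simps r_def)
    qed
    have "cnj z = of_real (norm z) * cis (- \<theta>)"
      by (metis \<theta>(3) cis_cnj complex_cnj_complex_of_real complex_cnj_mult)
    then have "cnj z * c = of_real p * cis (\<alpha> - \<theta>)"
      by (simp add: c_def p_def cis_mult mult_ac)
    \<comment> \<open>A radial part, at most x + m / 16, plus an angular part, at most half the arc
      length.\<close>
    then have "1 - cnj z * c = of_real (1 - p) + of_real p * (cis 0 - cis (\<alpha> - \<theta>))"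
      by (simp add: algebra_simps)
    then have "norm (1 - cnj z * c) \<le>
        norm (of_real (1 - p) :: complex) + norm (of_real p * (cis 0 - cis (\<alpha> - \<theta>)))"
      using norm_triangle_ineq by metis
    also have "\<dots> = (1 - p) + p * norm (cis 0 - cis (\<alpha> - \<theta>))"
      using p unfolding norm_mult norm_of_real by simp
    also have "p * norm (cis 0 - cis (\<alpha> - \<theta>)) \<le> 1 * \<bar>0 - (\<alpha> - \<theta>)\<bar>"
      using p by (intro mult_mono norm_cis_diff_le) auto
    also have "\<bar>0 - (\<alpha> - \<theta>)\<bar> \<le> m / 2"
      using \<theta> by (auto simp: m_def \<alpha>_def abs_le_iff field_simps)
    finally have D: "norm (1 - cnj z * c) \<le> 2 * m"
      using p x m by simp
    have "m / 4 ^ Suc k \<le> 1 - (norm z)\<^sup>2"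
    proof -
      have "(norm z)\<^sup>2 \<le> norm z"
        using z by (simp add: power2_eq_square mult_left_le)
      then show ?thesis
        using N by (simp add: k x_def)
    qed
    moreover have "m / 16 \<le> 1 - (norm c)\<^sup>2"
    proof -
      have "r\<^sup>2 \<le> r"
        using r by (simp add: power2_eq_square mult_left_le)
      then show ?thesis
        by (simp add: norm_c) (simp add: r_def)
    qed
    ultimately have "m / 4 ^ Suc k * (m / 16) \<le> (1 - (norm z)\<^sup>2) * (1 - (norm c)\<^sup>2)"
      using m z by (intro mult_mono) (auto simp: power_le_one)
    then have "exp (2 * hyp_dist z c) * (m / 4 ^ Suc k * (m / 16)) \<le>
        exp (2 * hyp_dist z c) * ((1 - (norm z)\<^sup>2) * (1 - (norm c)\<^sup>2))"
      by (rule mult_left_mono) simp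
    also have "\<dots> \<le> 4 * (norm (1 - cnj z * c))\<^sup>2"
      by (rule exp_hyp_dist_bounds(2)[OF z c])
    also have "\<dots> \<le> 4 * (2 * m)\<^sup>2"
      using D by (intro mult_left_mono power_mono) auto
    \<comment> \<open>The constant is 4 * 2^2 * 16 * 4; the last factor comes from the exponent
      \<open>Suc k\<close>.\<close>
    finally have "exp (2 * hyp_dist z c) \<le> 1024 * 4 ^ k"
      using m by (simp add: field_simps power2_eq_square)
    then have "(exp (hyp_dist z c))\<^sup>2 \<le> (32 * 2 ^ k)\<^sup>2"
      by (simp add: exp_double power_mult_distrib power2_eq_square flip: power_mult_distrib)
    then have "exp (hyp_dist z c) \<le> 32 * 2 ^ k"
      by (rule power2_le_imp_le) simp
    \<comment> \<open>The layers are nested, not disjoint; a single term of the series already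
      dominates.\<close>
    then have "ennreal (exp (hyp_dist z c)) * indicator (carleson_square (cis ` J)) z \<le> f k"
      using True xk by (simp add: f_def L_def x_def ennreal_leI)
    also have "f k = sum f {k}"
      by simp
    also have "\<dots> \<le> (\<Sum>i. f i)"
      by (rule sum_le_suminf) auto
    finally show ?thesis
      by (simp add: f_def)
  qed simp
  have "(\<integral>\<^sup>+z\<in>carleson_square (cis ` J). ennreal (exp (hyp_dist z c)) \<partial>disc_area) \<le>
      (\<integral>\<^sup>+z. (\<Sum>k. ennreal (32 * 2 ^ k) * indicator (L k) z) \<partial>disc_area)"
    by (intro nn_integral_mono pointwise)
  also have "\<dots> = (\<Sum>k. \<integral>\<^sup>+z. ennreal (32 * 2 ^ k) * indicator (L k) z \<partial>disc_area)"
    using L by (intro nn_integral_suminf) auto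
  also have "\<dots> = (\<Sum>k. ennreal (32 * 2 ^ k) * emeasure disc_area (L k))"
    using L by (subst nn_integral_cmult_indicator) auto
  also have "\<dots> \<le> (\<Sum>k. ennreal (128 * m\<^sup>2 * (1 / 2) ^ k))"
  proof (rule suminf_le)
    fix k
    have "ennreal (32 * 2 ^ k) * emeasure disc_area (L k) \<le>
        ennreal (32 * 2 ^ k) * ennreal (4 * m\<^sup>2 / 4 ^ k)"
      unfolding L_def by (intro mult_left_mono emeasure_carleson_layer_le) auto
    also have "\<dots> = ennreal (32 * 2 ^ k * (4 * m\<^sup>2 / 4 ^ k))"
      by (rule ennreal_mult[symmetric]) auto
    also have "32 * 2 ^ k * (4 * m\<^sup>2 / 4 ^ k) = 128 * m\<^sup>2 * (2 ^ k / 4 ^ k)"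
      by simp
    also have "(2 :: real) ^ k / 4 ^ k = (1 / 2) ^ k"
      by (simp flip: power_divide)
    finally show "ennreal (32 * 2 ^ k) * emeasure disc_area (L k) \<le>
        ennreal (128 * m\<^sup>2 * (1 / 2) ^ k)" .
  qed auto
  also have "\<dots> = ennreal (256 * m\<^sup>2)"
  proof -
    have "(\<lambda>k. 128 * m\<^sup>2 * (1 / 2) ^ k) sums (128 * m\<^sup>2 * 2)"
      using geometric_sums[of "1 / 2 :: real"] by (intro sums_mult) simp
    then show ?thesis
      by (intro suminf_ennreal_eq) auto
  qed
  finally show "(\<integral>\<^sup>+z\<in>carleson_square (cis ` J). ennreal (exp (hyp_dist z c)) \<partial>disc_area) \<le>
      ennreal (256 * m\<^sup>2)" .
qed

end

subsection \<open>Lipschitz approximation\<close>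

lemma continuous_on_hyp_dist:
  assumes "norm z < 1"
  shows "continuous_on unit_disc (hyp_dist z)"
proof -
  have "norm (z - \<zeta>) / norm (1 - cnj z * \<zeta>) < 1" "1 - cnj z * \<zeta> \<noteq> 0" if "\<zeta> \<in> unit_disc" for \<zeta>
    using norm_disc_moebius_less_1[OF assms, of \<zeta>] norm_one_minus_cnj_mult_pos[OF assms, of \<zeta>] that
    by (auto simp: norm_disc_moebius)
  moreover have "0 < 1 + norm (z - \<zeta>) / norm (1 - cnj z * \<zeta>)" for \<zeta>
    by (rule add_pos_nonneg) auto
  ultimately show ?thesis
    unfolding hyp_dist_def[abs_def] norm_disc_moebius
    by (intro continuous_intros) (auto simp: less_imp_neq[symmetric] less_imp_neq)
qed

text \<open>This is the source of measurability for functions known only through their Lipschitz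
  bound.\<close>

lemma continuous_on_if_hyp_dist_Lipschitz:
  fixes v :: "complex \<Rightarrow> real"
  assumes "\<And>z \<zeta>. norm z < 1 \<Longrightarrow> norm \<zeta> < 1 \<Longrightarrow> \<bar>v z - v \<zeta>\<bar> \<le> \<epsilon> * hyp_dist z \<zeta>"
  shows "continuous_on unit_disc v"
  unfolding continuous_on_def
proof
  fix z assume z: "z \<in> unit_disc"
  then have "\<forall>\<zeta>\<in>unit_disc. (hyp_dist z \<longlongrightarrow> hyp_dist z \<zeta>) (at \<zeta> within unit_disc)"
    using continuous_on_hyp_dist[of z] by (simp add: continuous_on_def)
  then have "(hyp_dist z \<longlongrightarrow> hyp_dist z z) (at z within unit_disc)"
    using z by (rule bspec)
  then have "((\<lambda>\<zeta>. \<epsilon> * hyp_dist z \<zeta>) \<longlongrightarrow> \<epsilon> * 0) (at z within unit_disc)"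
    by (intro tendsto_intros) simp
  then have lim: "((\<lambda>\<zeta>. \<epsilon> * hyp_dist z \<zeta>) \<longlongrightarrow> 0) (at z within unit_disc)"
    by simp
  have "norm (v \<zeta> - v z) \<le> \<epsilon> * hyp_dist z \<zeta>" if "\<zeta> \<in> unit_disc" for \<zeta>
    using assms[of z \<zeta>] z that by (simp add: abs_minus_commute[of "v z"])
  then have "\<forall>\<^sub>F \<zeta> in at z within unit_disc. norm (v \<zeta> - v z) \<le> \<epsilon> * hyp_dist z \<zeta>"
    by (simp add: eventually_at_filter)
  then have "((\<lambda>\<zeta>. v \<zeta> - v z) \<longlongrightarrow> 0) (at z within unit_disc)"
    using lim by (rule Lim_null_comparison)
  then show "(v \<longlongrightarrow> v z) (at z within unit_disc)"
    by (simp add: Lim_null[of v])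
qed

lemma hlip_norm_le:
  assumes "0 \<le> \<epsilon>" "\<And>z \<zeta>. norm z < 1 \<Longrightarrow> norm \<zeta> < 1 \<Longrightarrow> \<bar>v z - v \<zeta>\<bar> \<le> \<epsilon> * hyp_dist z \<zeta>"
  shows "hlip_norm v \<le> ennreal \<epsilon>"
  unfolding hlip_norm_def
proof (intro SUP_least, clarify)
  fix z \<zeta> :: complex assume z: "z \<in> unit_disc" "\<zeta> \<in> unit_disc" "z \<noteq> \<zeta>"
  then have "0 < hyp_dist z \<zeta>"
    by (intro hyp_dist_pos) auto
  then show "ennreal (\<bar>v z - v \<zeta>\<bar> / hyp_dist z \<zeta>) \<le> ennreal \<epsilon>"
    using assms z by (intro ennreal_leI) (simp add: pos_divide_le_eq)
qed

lemma hlip_norm_lessD: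
  assumes "hlip_norm v < ennreal \<epsilon>" "norm z < 1" "norm \<zeta> < 1"
  shows "\<bar>v z - v \<zeta>\<bar> \<le> \<epsilon> * hyp_dist z \<zeta>"
proof (cases "z = \<zeta>")
  case False
  have pos: "0 < hyp_dist z \<zeta>"
    using assms False by (intro hyp_dist_pos) auto
  have "ennreal (\<bar>v z - v \<zeta>\<bar> / hyp_dist z \<zeta>) \<le> hlip_norm v"
    unfolding hlip_norm_def using assms False by (intro SUP_upper2[of "(z, \<zeta>)"]) auto
  then have "ennreal (\<bar>v z - v \<zeta>\<bar> / hyp_dist z \<zeta>) < ennreal \<epsilon>"
    using assms(1) by (rule le_less_trans)
  then have "\<bar>v z - v \<zeta>\<bar> / hyp_dist z \<zeta> < \<epsilon>"
    using pos by (subst (asm) ennreal_less_iff) auto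
  then show ?thesis
    using pos by (simp add: field_simps)
qed simp

text \<open>The infimum v is the largest minorant of u that is \<epsilon>-Lipschitz for beta. The
  triangle inequality yields the Lipschitz bound, the growth hypothesis yields u - C <= v <= u.
  Being continuous, v is measurable, and so is h = u - v.\<close>

lemma hlip_approximation:
  fixes u :: "complex \<Rightarrow> real"
  assumes meas: "u \<in> borel_measurable disc_area" and \<epsilon>: "0 \<le> \<epsilon>"
    and growth: "\<And>z \<zeta>. norm z < 1 \<Longrightarrow> norm \<zeta> < 1 \<Longrightarrow> \<bar>u z - u \<zeta>\<bar> \<le> C + \<epsilon> * hyp_dist z \<zeta>"
  shows "\<exists>h\<in>Linfty_disc. hlip_norm (\<lambda>z. u z - h z) \<le> ennreal \<epsilon>"
proof -
  define v where "v z = (INF \<zeta>\<in>unit_disc. u \<zeta> + \<epsilon> * hyp_dist z \<zeta>)" for z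
  have lower: "u z - C \<le> u \<zeta> + \<epsilon> * hyp_dist z \<zeta>" if "norm z < 1" "norm \<zeta> < 1" for z \<zeta>
    using growth[OF that] by linarith
  have bdd: "bdd_below ((\<lambda>\<zeta>. u \<zeta> + \<epsilon> * hyp_dist z \<zeta>) ` unit_disc)" if "norm z < 1" for z
    using lower that by (intro bdd_belowI2[of _ "u z - C"]) auto
  have v_le: "v z \<le> u \<zeta> + \<epsilon> * hyp_dist z \<zeta>" if "norm z < 1" "norm \<zeta> < 1" for z \<zeta>
    unfolding v_def using that by (intro cINF_lower bdd) auto
  have v_ge: "u z - C \<le> v z" if "norm z < 1" for z
    unfolding v_def using lower that by (intro cINF_greatest) auto
  have step: "v z \<le> v \<zeta> + \<epsilon> * hyp_dist z \<zeta>" if "norm z < 1" "norm \<zeta> < 1" for z \<zeta>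
  proof -
    have "v z - \<epsilon> * hyp_dist z \<zeta> \<le> v \<zeta>"
      unfolding v_def[of \<zeta>]
    proof (rule cINF_greatest)
      fix \<xi> :: complex assume "\<xi> \<in> unit_disc"
      then have \<xi>: "norm \<xi> < 1"
        by simp
      have "v z \<le> u \<xi> + \<epsilon> * hyp_dist z \<xi>"
        using that \<xi> by (intro v_le)
      also have "\<epsilon> * hyp_dist z \<xi> \<le> \<epsilon> * (hyp_dist z \<zeta> + hyp_dist \<zeta> \<xi>)"
        using that \<xi> \<epsilon> by (intro mult_left_mono hyp_dist_triangle)
      finally show "v z - \<epsilon> * hyp_dist z \<zeta> \<le> u \<xi> + \<epsilon> * hyp_dist \<zeta> \<xi>"
        by (simp add: algebra_simps)
    qed auto
    then show ?thesis
      by simp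
  qed
  have lip: "\<bar>v z - v \<zeta>\<bar> \<le> \<epsilon> * hyp_dist z \<zeta>" if "norm z < 1" "norm \<zeta> < 1" for z \<zeta>
    using step[OF that] step[OF that(2,1)] by (simp add: hyp_dist_commute[of z \<zeta>] abs_le_iff)
  define h where "h z = u z - v z" for z
  have "v \<in> borel_measurable disc_area"
    by (intro continuous_on_imp_measurable_disc_area continuous_on_if_hyp_dist_Lipschitz[OF lip])
  then have "h \<in> borel_measurable disc_area"
    unfolding h_def[abs_def] using meas by simp
  moreover have "AE z in disc_area. \<bar>h z\<bar> \<le> C"
  proof (rule AE_I2)
    fix z assume "z \<in> space disc_area"
    then show "\<bar>h z\<bar> \<le> C"
      using v_le[of z z] v_ge[of z] by (simp add: h_def abs_le_iff)
  qed
  ultimately have "h \<in> Linfty_disc"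
    by (auto simp: Linfty_disc_def)
  moreover have "hlip_norm (\<lambda>z. u z - h z) \<le> ennreal \<epsilon>"
    using lip by (intro hlip_norm_le \<epsilon>) (auto simp: h_def)
  ultimately show ?thesis
    by blast
qed

subsection \<open>Weights and oscillation\<close>

text \<open>The number \<alpha> is the lower bound (m / 32)^2 for the area, with m the arc length,
  and 2^18 = 256 * 32^2. Hence 2^18 bounds the mean of exp beta over every square.\<close>

lemma carleson_square_center:
  assumes "circle_arc I"
  obtains c \<alpha> where "norm c < 1" "0 < \<alpha>"
    "ennreal \<alpha> \<le> emeasure disc_area (carleson_square I)"
    "(\<integral>\<^sup>+z\<in>carleson_square I. ennreal (exp (hyp_dist z c)) \<partial>disc_area) \<le> ennreal (2 ^ 18 * \<alpha>)"
proof -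
  obtain a b J where I: "{a<..<b} \<subseteq> J" "J \<subseteq> {a..b}" "a < b" "b \<le> a + 2 * pi" "I = cis ` J"
    using assms by (auto simp: circle_arc_def)
  obtain c where c: "norm c < 1"
    "(\<integral>\<^sup>+z\<in>carleson_square (cis ` J). ennreal (exp (hyp_dist z c)) \<partial>disc_area) \<le>
      ennreal (256 * (b - a)\<^sup>2)"
    by (rule nn_integral_exp_hyp_dist_le[OF I(1-4)])
  have eq: "256 * (b - a)\<^sup>2 = 2 ^ 18 * ((b - a) / 32)\<^sup>2"
    by (simp add: power_divide)
  show ?thesis
  proof (rule that)
    show "0 < ((b - a) / 32)\<^sup>2"
      using I by simp
  qed (use c emeasure_carleson_square_ge[OF I(1-4)] in \<open>simp_all only: eq I(5)\<close>)
qed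

text \<open>Discs are contained in Carleson squares only after removal of the origin; integrals
  ignore the difference.\<close>

lemma AE_disc_area_nonzero: "AE z in disc_area. z \<in> unit_disc - {0}"
proof -
  have "{0} \<in> null_sets disc_area"
    by (intro null_setsI emeasure_disc_area_singleton borel_subset_in_sets_disc_area) auto
  then have "AE z in disc_area. z \<notin> {0}"
    by (rule AE_not_in)
  then show ?thesis
    using AE_space by eventually_elim simp
qed

lemma exp_hyp_dist_integrable_bound:
  obtains c K where "norm c < 1" "0 \<le> K"
    "(\<integral>\<^sup>+z. ennreal (exp (hyp_dist z c)) \<partial>disc_area) \<le> ennreal K"
proof -
  obtain c K where c: "norm c < 1"
    "(\<integral>\<^sup>+z\<in>carleson_square (cis ` {- pi..pi}). ennreal (exp (hyp_dist z c)) \<partial>disc_area) \<le>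
      ennreal (256 * (pi - - pi)\<^sup>2)"
    by (rule nn_integral_exp_hyp_dist_le[of "- pi" pi "{- pi..pi}"]) auto
  have "(\<integral>\<^sup>+z. ennreal (exp (hyp_dist z c)) \<partial>disc_area) =
      (\<integral>\<^sup>+z\<in>unit_disc - {0}. ennreal (exp (hyp_dist z c)) \<partial>disc_area)"
    by (intro nn_integral_cong_AE) (use AE_disc_area_nonzero in eventually_elim, simp)
  then show ?thesis
    using c by (intro that[of c "256 * (pi - - pi)\<^sup>2"]) (simp_all only: carleson_square_full, auto)
qed

lemma ennreal_inverse_antimono: "a \<le> b \<Longrightarrow> inverse b \<le> inverse (a :: ennreal)"
proof (cases "a = 0 \<or> b = top")
  case False
  assume "a \<le> b"
  with False obtain x y where xy: "a = ennreal x" "b = ennreal y" "0 \<le> x" "0 \<le> y"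
    by (cases a; cases b) (auto simp: top_unique)
  then have "0 < x" "x \<le> y"
    using False \<open>a \<le> b\<close> by (auto simp: less_le)
  with xy show ?thesis
    by (simp add: inverse_ennreal ennreal_leI le_imp_inverse_le)
qed auto

lemma divide_le_ennreal:
  assumes "X \<le> ennreal x" "ennreal \<alpha> \<le> A" "0 < \<alpha>" "0 \<le> x"
  shows "X / A \<le> ennreal (x / \<alpha>)"
proof -
  have "X * inverse A \<le> ennreal x * inverse (ennreal \<alpha>)"
    using assms by (intro mult_mono ennreal_inverse_antimono) auto
  then show ?thesis
    using assms by (simp add: divide_ennreal_def[symmetric] divide_ennreal)
qed

lemma divide_ge_ennreal:
  assumes "ennreal x \<le> X" "A \<le> ennreal \<alpha>" "0 < \<alpha>" "0 \<le> x"
  shows "ennreal (x / \<alpha>) \<le> X / A"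
proof -
  have "ennreal x * inverse (ennreal \<alpha>) \<le> X * inverse A"
    using assms by (intro mult_mono ennreal_inverse_antimono) auto
  then show ?thesis
    using assms by (simp add: divide_ennreal_def[symmetric] divide_ennreal)
qed

lemma measurable_hyp_dist_left:
  assumes "norm c < 1"
  shows "(\<lambda>z. hyp_dist z c) \<in> borel_measurable disc_area"
  using continuous_on_imp_measurable_disc_area[OF continuous_on_hyp_dist[OF assms]]
  by (simp add: hyp_dist_commute[of _ c])

section \<open>From growth bounds to the B2 condition\<close>

text \<open>On a square with reference point c, W and 1 / W are dominated by W c and 1 / W c times
  exp C * exp beta(., c). In the product of the two means W c cancels, so the bound (exp C * 2^18)^2
  is the same for all squares. Integrability of W comes from the same domination on the whole
  disc.\<close>

lemma B2_weight_if_growth: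
  fixes W :: "complex \<Rightarrow> real"
  assumes meas: "W \<in> borel_measurable disc_area" and pos: "\<And>z. norm z < 1 \<Longrightarrow> 0 < W z"
    and growth: "\<And>z \<zeta>. norm z < 1 \<Longrightarrow> norm \<zeta> < 1 \<Longrightarrow>
      \<bar>ln (W z) - ln (W \<zeta>)\<bar> \<le> C + hyp_dist z \<zeta>"
  shows "B2_weight W"
proof -
  have bounds: "W z \<le> W c * exp C * exp (hyp_dist z c)"
      "1 / W z \<le> 1 / W c * exp C * exp (hyp_dist z c)" if "norm z < 1" "norm c < 1" for z c
  proof -
    have "exp (ln (W z)) \<le> exp (ln (W c) + C + hyp_dist z c)"
      using growth[OF that] by (subst exp_le_cancel_iff) linarith
    then show "W z \<le> W c * exp C * exp (hyp_dist z c)"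
      using pos that by (simp add: exp_add)
    have "exp (ln (W c)) \<le> exp (ln (W z) + C + hyp_dist z c)"
      using growth[OF that] by (subst exp_le_cancel_iff) linarith
    then have "W c \<le> W z * (exp C * exp (hyp_dist z c))"
      using pos that by (simp add: exp_add)
    then show "1 / W z \<le> 1 / W c * exp C * exp (hyp_dist z c)"
      using pos[OF that(1)] pos[OF that(2)] by (simp add: field_simps)
  qed
  \<comment> \<open>General in g and S, to serve W on the whole disc and both W and 1 / W on each
    square.\<close>
  have integral_bound: "(\<integral>\<^sup>+z. ennreal (g z) * indicator S z \<partial>disc_area) \<le> ennreal (k * y)"
    if g: "\<And>z. norm z < 1 \<Longrightarrow> g z \<le> k * exp (hyp_dist z c)" and k: "0 \<le> k" and c: "norm c < 1"
      and S: "S \<in> sets disc_area" and y: "0 \<le> y"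
      "(\<integral>\<^sup>+z\<in>S. ennreal (exp (hyp_dist z c)) \<partial>disc_area) \<le> ennreal y" for g k c S y
  proof -
    note [measurable] = S measurable_hyp_dist_left[OF c]
    have "(\<integral>\<^sup>+z. ennreal (g z) * indicator S z \<partial>disc_area) \<le>
        (\<integral>\<^sup>+z. ennreal k * (ennreal (exp (hyp_dist z c)) * indicator S z) \<partial>disc_area)"
    proof (rule nn_integral_mono)
      fix z assume "z \<in> space disc_area"
      then have "ennreal (g z) \<le> ennreal (k * exp (hyp_dist z c))"
        using g by (intro ennreal_leI) auto
      then show "ennreal (g z) * indicator S z \<le>
          ennreal k * (ennreal (exp (hyp_dist z c)) * indicator S z)"
        using k by (auto simp: ennreal_mult indicator_def)
    qed
    also have "\<dots> = ennreal k * (\<integral>\<^sup>+z\<in>S. ennreal (exp (hyp_dist z c)) \<partial>disc_area)"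
      by (intro nn_integral_cmult) measurable
    also have "\<dots> \<le> ennreal k * ennreal y"
      using y by (intro mult_left_mono) auto
    finally show ?thesis
      using k y by (simp add: ennreal_mult)
  qed
  have "weight W"
    unfolding weight_def
  proof (intro conjI ballI)
    obtain c K where c: "norm c < 1" "0 \<le> K"
      "(\<integral>\<^sup>+z. ennreal (exp (hyp_dist z c)) \<partial>disc_area) \<le> ennreal K"
      by (rule exp_hyp_dist_integrable_bound)
    have ind: "(\<integral>\<^sup>+z. f z * indicator unit_disc z \<partial>disc_area) = (\<integral>\<^sup>+z. f z \<partial>disc_area)" for f
      by (intro nn_integral_cong) simp
    have "(\<integral>\<^sup>+z. ennreal (W z) * indicator unit_disc z \<partial>disc_area) \<le> ennreal (W c * exp C * K)"
      using c pos[OF c(1)] bounds(1)[OF _ c(1)]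
      by (rule_tac integral_bound[where c = c]) (auto simp: ind borel_subset_in_sets_disc_area)
    also have "\<dots> < \<infinity>"
      by simp
    finally show "integrable disc_area W"
      using meas pos by (intro integrableI_nonneg AE_I2) (auto simp: ind less_imp_le)
  qed (use pos in auto)
  moreover have "B2_char_sq W \<le> ennreal ((exp C)\<^sup>2 * 2 ^ 36)"
    unfolding B2_char_sq_def
  proof (rule SUP_least)
    fix I assume "I \<in> Collect circle_arc"
    then have I: "circle_arc I"
      by simp
    obtain c \<alpha> where c: "norm c < 1" "0 < \<alpha>"
      "ennreal \<alpha> \<le> emeasure disc_area (carleson_square I)"
      "(\<integral>\<^sup>+z\<in>carleson_square I. ennreal (exp (hyp_dist z c)) \<partial>disc_area) \<le> ennreal (2 ^ 18 * \<alpha>)"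
      by (rule carleson_square_center[OF I])
    let ?Q = "carleson_square I"
    have Wc: "0 < W c"
      by (rule pos[OF c(1)])
    have "(\<integral>\<^sup>+z\<in>?Q. ennreal (W z) \<partial>disc_area) \<le> ennreal (W c * exp C * (2 ^ 18 * \<alpha>))"
      using c Wc bounds(1)[OF _ c(1)] carleson_square_in_sets[OF I]
      by (rule_tac integral_bound[where c = c]) auto
    then have 1: "(\<integral>\<^sup>+z\<in>?Q. ennreal (W z) \<partial>disc_area) / emeasure disc_area ?Q \<le>
        ennreal (W c * exp C * (2 ^ 18 * \<alpha>) / \<alpha>)"
      by (rule divide_le_ennreal[OF _ c(3,2)]) (use Wc c(2) in simp)
    have "(\<integral>\<^sup>+z\<in>?Q. ennreal (1 / W z) \<partial>disc_area) \<le> ennreal (1 / W c * exp C * (2 ^ 18 * \<alpha>))"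
      using c Wc bounds(2)[OF _ c(1)] carleson_square_in_sets[OF I]
      by (rule_tac integral_bound[where c = c]) auto
    then have 2: "(\<integral>\<^sup>+z\<in>?Q. ennreal (1 / W z) \<partial>disc_area) / emeasure disc_area ?Q \<le>
        ennreal (1 / W c * exp C * (2 ^ 18 * \<alpha>) / \<alpha>)"
      by (rule divide_le_ennreal[OF _ c(3,2)]) (use Wc c(2) in simp)
    have "(\<integral>\<^sup>+z\<in>?Q. ennreal (W z) \<partial>disc_area) / emeasure disc_area ?Q *
        ((\<integral>\<^sup>+z\<in>?Q. ennreal (1 / W z) \<partial>disc_area) / emeasure disc_area ?Q) \<le>
        ennreal (W c * exp C * (2 ^ 18 * \<alpha>) / \<alpha>) * ennreal (1 / W c * exp C * (2 ^ 18 * \<alpha>) / \<alpha>)"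
      using 1 2 by (intro mult_mono) auto
    also have "\<dots> = ennreal (W c * exp C * (2 ^ 18 * \<alpha>) / \<alpha> * (1 / W c * exp C * (2 ^ 18 * \<alpha>) / \<alpha>))"
      using c Wc by (intro ennreal_mult[symmetric]) auto
    also have "W c * exp C * (2 ^ 18 * \<alpha>) / \<alpha> * (1 / W c * exp C * (2 ^ 18 * \<alpha>) / \<alpha>) =
        (exp C)\<^sup>2 * 2 ^ 36"
      using c Wc by (simp add: field_simps power2_eq_square)
    finally show "(\<integral>\<^sup>+z\<in>?Q. ennreal (W z) \<partial>disc_area) / emeasure disc_area ?Q *
        ((\<integral>\<^sup>+z\<in>?Q. ennreal (1 / W z) \<partial>disc_area) / emeasure disc_area ?Q) \<le>
        ennreal ((exp C)\<^sup>2 * 2 ^ 36)" .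
  qed
  then have "B2_char_sq W < \<infinity>"
    by (rule le_less_trans) simp
  ultimately show ?thesis
    by (simp add: B2_weight_def)
qed

section \<open>From the B2 condition to growth bounds\<close>

text \<open>Of the integral only the contribution of the disc, of area r^2, is kept, and the area of
  the square is bounded by 4 (b - a)^2.\<close>

lemma carleson_average_ge:
  assumes ab: "a < b" "b \<le> a + 2 * pi" and z: "norm z < 1" and r: "r = (1 - norm z) / 2"
    and sub: "ball z r - {0} \<subseteq> carleson_square (cis ` {a..b})"
    and g: "\<And>\<xi>. \<xi> \<in> ball z r \<Longrightarrow> y \<le> g \<xi>" and y: "0 \<le> y"
  shows "ennreal (y * r\<^sup>2 / (4 * (b - a)\<^sup>2)) \<le>
    (\<integral>\<^sup>+\<xi>\<in>carleson_square (cis ` {a..b}). ennreal (g \<xi>) \<partial>disc_area) /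
      emeasure disc_area (carleson_square (cis ` {a..b}))"
proof (rule divide_ge_ennreal)
  let ?Q = "carleson_square (cis ` {a..b})"
  show "emeasure disc_area ?Q \<le> ennreal (4 * (b - a)\<^sup>2)"
    using ab by (intro emeasure_carleson_square_le) auto
  have B: "ball z r \<subseteq> unit_disc" "0 \<le> r"
    using ball_half_subset_unit_disc[OF z] z by (auto simp: r)
  then have sets: "ball z r \<in> sets disc_area"
    by (intro borel_subset_in_sets_disc_area) auto
  have "ennreal (y * r\<^sup>2) = ennreal y * emeasure disc_area (ball z r)"
    using B y by (simp add: emeasure_disc_area_ball ennreal_mult)
  also have "\<dots> = (\<integral>\<^sup>+\<xi>. ennreal y * indicator (ball z r) \<xi> \<partial>disc_area)"
    by (rule nn_integral_cmult_indicator[OF sets, symmetric])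
  also have "\<dots> \<le> (\<integral>\<^sup>+\<xi>\<in>?Q. ennreal (g \<xi>) \<partial>disc_area)"
  proof (rule nn_integral_mono_AE)
    show "AE \<xi> in disc_area. ennreal y * indicator (ball z r) \<xi> \<le> ennreal (g \<xi>) * indicator ?Q \<xi>"
      using AE_disc_area_nonzero
    proof eventually_elim
      case (elim \<xi>)
      then show ?case
        using sub g[of \<xi>] by (auto simp: indicator_def intro!: ennreal_leI)
    qed
  qed
  finally show "ennreal (y * r\<^sup>2) \<le> (\<integral>\<^sup>+\<xi>\<in>?Q. ennreal (g \<xi>) \<partial>disc_area)" .
qed (use ab y in auto)

text \<open>The point is that the coefficient 4 depends neither on C nor on the B2 characteristic,
  both of which enter only K. Passing from the square to the two discs costs the area ratios r^2 /
  d^2 and s^2 / d^2 up to constants, and (r s / d^2)^2 is at least a constant times exp (-4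
  beta).\<close>

lemma growth_if_B2_char_sq_finite:
  fixes W :: "complex \<Rightarrow> real"
  assumes pos: "\<And>z. norm z < 1 \<Longrightarrow> 0 < W z" and C: "0 \<le> C"
    and osc: "\<And>z \<zeta>. norm z < 1 \<Longrightarrow> norm \<zeta> < 1 \<Longrightarrow>
      \<bar>ln (W z) - ln (W \<zeta>)\<bar> \<le> C * (1 + hyp_dist z \<zeta>)"
    and B2: "B2_char_sq W < \<infinity>"
  obtains K where "\<And>z \<zeta>. norm z < 1 \<Longrightarrow> norm \<zeta> < 1 \<Longrightarrow>
    \<bar>ln (W z) - ln (W \<zeta>)\<bar> \<le> K + 4 * hyp_dist z \<zeta>"
proof -
  obtain k where k: "0 \<le> k" "B2_char_sq W = ennreal k"
    using B2 by (cases "B2_char_sq W") auto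
  \<comment> \<open>16 is the square of the constant 4 in the area of a square, 25600 = 40^2 * 16
    comes from (b - a)^2 <= 1600 d^2 and d^2 <= 16 exp (2 beta) r s, and exp (4 C) from the
    variation of W on the two discs. With k + 1 for k, H is positive and has a logarithm.\<close>
  define H where "H = 16 * 25600 ^ 2 * exp (4 * C) * (k + 1)"
  have H: "0 < H"
    using k by (simp add: H_def)
  have near: "exp (- 2 * C) * W z \<le> W \<xi>" "exp (- 2 * C) * (1 / W z) \<le> 1 / W \<xi>"
    if z: "norm z < 1" and \<xi>: "\<xi> \<in> ball z ((1 - norm z) / 2)" for z \<xi>
  proof -
    have \<xi>1: "norm \<xi> < 1"
      using ball_half_subset_unit_disc[OF z] \<xi> by auto
    have "C * (1 + hyp_dist z \<xi>) \<le> C * 2"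
      using hyp_dist_ball_half_le_1[OF z \<xi>] C by (intro mult_left_mono) auto
    then have *: "\<bar>ln (W z) - ln (W \<xi>)\<bar> \<le> 2 * C"
      using osc[OF z \<xi>1] by simp
    have "exp (- 2 * C + ln (W z)) \<le> exp (ln (W \<xi>))"
      using * by (subst exp_le_cancel_iff) linarith
    then show "exp (- 2 * C) * W z \<le> W \<xi>"
      using pos[OF z] pos[OF \<xi>1] by (simp only: exp_add exp_ln)
    have "exp (- 2 * C + - ln (W z)) \<le> exp (- ln (W \<xi>))"
      using * by (subst exp_le_cancel_iff) linarith
    then show "exp (- 2 * C) * (1 / W z) \<le> 1 / W \<xi>"
      using pos z \<xi>1 by (simp only: exp_add) (simp add: exp_minus field_simps)
  qed
  have main: "ln (W z) - ln (W \<zeta>) \<le> ln H + 4 * hyp_dist z \<zeta>"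
    if z: "norm z < 1" and \<zeta>: "norm \<zeta> < 1" for z \<zeta>
  proof -
    define d where "d = norm (1 - cnj z * \<zeta>)"
    define r s where "r = (1 - norm z) / 2" and "s = (1 - norm \<zeta>) / 2"
    have rs: "0 < r" "0 < s" and d: "0 < d"
      using z \<zeta> norm_one_minus_cnj_mult_pos by (auto simp: r_def s_def d_def)
    have dz: "1 - norm z \<le> d" and d\<zeta>: "1 - norm \<zeta> \<le> d" and dist: "norm (z - \<zeta>) < d"
      using norm_one_minus_cnj_mult_ge[OF z \<zeta>] norm_diff_less_one_minus_cnj_mult[OF z \<zeta>]
      by (auto simp: d_def)
    obtain a b where ab: "a < b" "b \<le> a + 2 * pi" "b - a \<le> 40 * d"
        "ball z (3 * d / 2) \<inter> unit_disc - {0} \<subseteq> carleson_square (cis ` {a..b})"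
      \<comment> \<open>This one square serves both discs: r and s are at most d / 2, and |z -
        \<zeta>| < d.\<close>
      using ball_subset_carleson_square[OF z dz] by blast
    let ?Q = "carleson_square (cis ` {a..b})"
    have "ball z r \<subseteq> ball z (3 * d / 2)"
      using dz d by (intro subset_ball) (simp add: r_def)
    then have sub1: "ball z r - {0} \<subseteq> ?Q"
      using ab(4) ball_half_subset_unit_disc[OF z] unfolding r_def by blast
    have "dist \<zeta> z < d"
      using dist by (metis dist_commute dist_norm)
    moreover have "s \<le> d / 2"
      using d\<zeta> by (simp add: s_def)
    ultimately have "dist \<zeta> z + s \<le> 3 * d / 2"
      by simp
    then have "ball \<zeta> s \<subseteq> ball z (3 * d / 2)"
      by (simp add: ball_subset_ball_iff)
    then have sub2: "ball \<zeta> s - {0} \<subseteq> ?Q"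
      using ab(4) ball_half_subset_unit_disc[OF \<zeta>] unfolding s_def by blast
    \<comment> \<open>W is averaged using the disc at z and 1 / W using the disc at \<zeta>, so that
      the product contains W z / W \<zeta>.\<close>
    define A B where "A = exp (- 2 * C) * W z * r\<^sup>2 / (4 * (b - a)\<^sup>2)"
      and "B = exp (- 2 * C) * (1 / W \<zeta>) * s\<^sup>2 / (4 * (b - a)\<^sup>2)"
    have AB: "0 \<le> A" "0 \<le> B"
      using pos[OF z] pos[OF \<zeta>] by (auto simp: A_def B_def)
    have A: "ennreal A \<le> (\<integral>\<^sup>+\<xi>\<in>?Q. ennreal (W \<xi>) \<partial>disc_area) / emeasure disc_area ?Q"
      unfolding A_def using near(1)[OF z] pos[OF z]
      by (intro carleson_average_ge[OF ab(1,2) z r_def sub1]) (auto simp: r_def)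
    have B: "ennreal B \<le> (\<integral>\<^sup>+\<xi>\<in>?Q. ennreal (1 / W \<xi>) \<partial>disc_area) / emeasure disc_area ?Q"
      unfolding B_def using near(2)[OF \<zeta>] pos[OF \<zeta>]
      by (intro carleson_average_ge[OF ab(1,2) \<zeta> s_def sub2]) (auto simp: s_def)
    have "ennreal (A * B) = ennreal A * ennreal B"
      using AB by (simp add: ennreal_mult)
    also have "\<dots> \<le> (\<integral>\<^sup>+\<xi>\<in>?Q. ennreal (W \<xi>) \<partial>disc_area) / emeasure disc_area ?Q *
        ((\<integral>\<^sup>+\<xi>\<in>?Q. ennreal (1 / W \<xi>) \<partial>disc_area) / emeasure disc_area ?Q)"
      using A B by (intro mult_mono) auto
    also have "\<dots> \<le> B2_char_sq W"
      unfolding B2_char_sq_def using circle_arc_cis_Icc[OF ab(1,2)] by (intro SUP_upper) auto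
    finally have "A * B \<le> k"
      using k by simp
    have d2: "d\<^sup>2 \<le> 16 * exp (2 * hyp_dist z \<zeta>) * (r * s)"
      using norm_one_minus_cnj_mult_sq_le[OF z \<zeta>] by (simp add: d_def r_def s_def mult_ac)
    have "(b - a)\<^sup>2 \<le> (40 * d)\<^sup>2"
      using ab by (intro power_mono) auto
    then have "(b - a)\<^sup>2 \<le> 25600 * exp (2 * hyp_dist z \<zeta>) * (r * s)"
      using d2 by (simp add: power_mult_distrib)
    then have "((b - a)\<^sup>2)\<^sup>2 \<le> (25600 * exp (2 * hyp_dist z \<zeta>) * (r * s))\<^sup>2"
      by (intro power_mono) auto
    also have "\<dots> = 25600\<^sup>2 * exp (4 * hyp_dist z \<zeta>) * (r\<^sup>2 * s\<^sup>2)"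
      by (simp add: power_mult_distrib flip: exp_double)
    finally have m4: "((b - a)\<^sup>2)\<^sup>2 \<le> 25600\<^sup>2 * exp (4 * hyp_dist z \<zeta>) * (r\<^sup>2 * s\<^sup>2)" .
    define q where "q = W z / W \<zeta>"
    have q: "0 < q"
      using pos[OF z] pos[OF \<zeta>] by (simp add: q_def)
    have "A * B = exp (- 4 * C) * q * (r\<^sup>2 * s\<^sup>2) / (16 * ((b - a)\<^sup>2)\<^sup>2)"
      using exp_add[of "- (2 * C)" "- (2 * C)"]
      by (simp add: A_def B_def q_def power2_eq_square field_simps)
    then have "exp (- 4 * C) * q * (r\<^sup>2 * s\<^sup>2) \<le> k * (16 * ((b - a)\<^sup>2)\<^sup>2)"
      using \<open>A * B \<le> k\<close> ab by (simp add: pos_divide_le_eq)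
    also have "\<dots> \<le> k * (16 * (25600\<^sup>2 * exp (4 * hyp_dist z \<zeta>) * (r\<^sup>2 * s\<^sup>2)))"
      using m4 k by (intro mult_left_mono) auto
    finally have "exp (- 4 * C) * q * (r\<^sup>2 * s\<^sup>2) \<le>
        k * 16 * 25600\<^sup>2 * exp (4 * hyp_dist z \<zeta>) * (r\<^sup>2 * s\<^sup>2)"
      by (simp add: mult_ac)
    then have "exp (- 4 * C) * q \<le> k * 16 * 25600\<^sup>2 * exp (4 * hyp_dist z \<zeta>)"
      using rs by (subst (asm) mult_le_cancel_right_pos) auto
    also have "\<dots> \<le> (k + 1) * 16 * 25600\<^sup>2 * exp (4 * hyp_dist z \<zeta>)"
      by (intro mult_right_mono) auto
    finally have le: "exp (- 4 * C) * q \<le> (k + 1) * 16 * 25600\<^sup>2 * exp (4 * hyp_dist z \<zeta>)" .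
    have "q = exp (4 * C) * (exp (- 4 * C) * q)"
      by (simp flip: exp_add mult.assoc)
    also have "\<dots> \<le> exp (4 * C) * ((k + 1) * 16 * 25600\<^sup>2 * exp (4 * hyp_dist z \<zeta>))"
      using le by (rule mult_left_mono) simp
    also have "\<dots> = H * exp (4 * hyp_dist z \<zeta>)"
      by (simp only: H_def mult_ac)
    finally have "q \<le> H * exp (4 * hyp_dist z \<zeta>)" .
    then have "ln q \<le> ln (H * exp (4 * hyp_dist z \<zeta>))"
      using q H by (subst ln_le_cancel_iff) auto
    then show ?thesis
      using pos[OF z] pos[OF \<zeta>] H by (simp add: q_def ln_div ln_mult)
  qed
  show ?thesis
  proof (rule that[of "ln H"])
    fix z \<zeta> :: complex assume "norm z < 1" "norm \<zeta> < 1"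
    then show "\<bar>ln (W z) - ln (W \<zeta>)\<bar> \<le> ln H + 4 * hyp_dist z \<zeta>"
      using main[of z \<zeta>] main[of \<zeta> z] by (simp add: hyp_dist_commute[of z] abs_le_iff)
  qed
qed

subsection \<open>Mean oscillation\<close>

lemma le_exp: "x \<le> exp (x :: real)"
  using exp_ge_add_one_self[of x] by linarith

lemma integrable_if_hyp_dist_Lipschitz:
  fixes v :: "complex \<Rightarrow> real"
  assumes \<epsilon>: "0 \<le> \<epsilon>"
    and lip: "\<And>z \<zeta>. norm z < 1 \<Longrightarrow> norm \<zeta> < 1 \<Longrightarrow> \<bar>v z - v \<zeta>\<bar> \<le> \<epsilon> * hyp_dist z \<zeta>"
  shows "integrable disc_area v"
proof -
  obtain c K where c: "norm c < 1" "0 \<le> K"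
    "(\<integral>\<^sup>+z. ennreal (exp (hyp_dist z c)) \<partial>disc_area) \<le> ennreal K"
    by (rule exp_hyp_dist_integrable_bound)
  have "integrable disc_area (\<lambda>z. exp (hyp_dist z c))"
    using c measurable_hyp_dist_left[OF c(1)]
    by (intro integrableI_nonneg) (auto simp: le_less_trans)
  then have "integrable disc_area (\<lambda>z. \<bar>v c\<bar> + \<epsilon> * exp (hyp_dist z c))"
    by (intro Bochner_Integration.integrable_add integrable_mult_right
        finite_measure.integrable_const finite_measure_disc_area)
  then show ?thesis
  proof (rule Bochner_Integration.integrable_bound)
    show "v \<in> borel_measurable disc_area"
      by (intro continuous_on_imp_measurable_disc_area continuous_on_if_hyp_dist_Lipschitz[OF lip])
    show "AE z in disc_area. norm (v z) \<le> norm (\<bar>v c\<bar> + \<epsilon> * exp (hyp_dist z c))"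
    proof (rule AE_I2)
      fix z assume "z \<in> space disc_area"
      then have "\<bar>v z - v c\<bar> \<le> \<epsilon> * hyp_dist z c"
        using lip[of z c] c by simp
      also have "\<dots> \<le> \<epsilon> * exp (hyp_dist z c)"
        using \<epsilon> le_exp[of "hyp_dist z c"] by (intro mult_left_mono) auto
      finally show "norm (v z) \<le> norm (\<bar>v c\<bar> + \<epsilon> * exp (hyp_dist z c))"
        unfolding real_norm_def by linarith
    qed
  qed
qed

lemma set_integrable_disc_area:
  fixes f :: "complex \<Rightarrow> real"
  assumes "integrable disc_area f" "S \<in> sets disc_area"
  shows "set_integrable disc_area S f"
  using integrable_mult_indicator[OF assms(2,1)] by (simp add: set_integrable_def)

lemma set_nn_integral_abs_eq:
  fixes f :: "complex \<Rightarrow> real"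
  assumes "integrable disc_area f" "S \<in> sets disc_area"
  shows "(\<integral>\<^sup>+z\<in>S. ennreal \<bar>f z\<bar> \<partial>disc_area) = ennreal (LINT z:S|disc_area. \<bar>f z\<bar>)"
proof -
  have "integrable disc_area (\<lambda>z. indicator S z *\<^sub>R \<bar>f z\<bar>)"
    using set_integrable_disc_area[OF integrable_abs[OF assms(1)] assms(2)]
    by (simp add: set_integrable_def)
  then have "(\<integral>\<^sup>+z. ennreal (indicator S z *\<^sub>R \<bar>f z\<bar>) \<partial>disc_area) =
      ennreal (LINT z:S|disc_area. \<bar>f z\<bar>)"
    unfolding set_lebesgue_integral_def by (intro nn_integral_eq_integral) auto
  moreover have "(\<integral>\<^sup>+z\<in>S. ennreal \<bar>f z\<bar> \<partial>disc_area) =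
      (\<integral>\<^sup>+z. ennreal (indicator S z *\<^sub>R \<bar>f z\<bar>) \<partial>disc_area)"
    by (intro nn_integral_cong) (auto simp: indicator_def)
  ultimately show ?thesis
    by simp
qed

lemma set_integral_const_disc_area:
  fixes y :: real
  assumes "S \<in> sets disc_area"
  shows "(LINT z:S|disc_area. y) = measure disc_area S * y"
proof -
  have "S \<inter> unit_disc = S"
    using sets.sets_into_space[OF assms] by auto
  then show ?thesis
    using assms emeasure_disc_area_eq_measure by (simp add: set_lebesgue_integral_def)
qed

lemma disc_mean_diff_const:
  assumes f: "integrable disc_area f" and S: "S \<in> sets disc_area" and pos: "0 < measure disc_area S"
  shows "measure disc_area S * \<bar>disc_mean f S - y\<bar> \<le> (LINT z:S|disc_area. \<bar>f z - y\<bar>)"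
proof -
  note const = finite_measure.integrable_const[OF finite_measure_disc_area]
  have "set_integrable disc_area S f" "set_integrable disc_area S (\<lambda>_. y)"
    using f S const by (auto intro: set_integrable_disc_area)
  then have "(LINT z:S|disc_area. f z - y) = (LINT z:S|disc_area. f z) - (LINT z:S|disc_area. y)"
    by (rule set_integral_diff(2))
  also have "(LINT z:S|disc_area. y) = measure disc_area S * y"
    by (rule set_integral_const_disc_area[OF S])
  finally have "measure disc_area S * (disc_mean f S - y) = (LINT z:S|disc_area. f z - y)"
    using pos by (simp add: disc_mean_def algebra_simps)
  then have "measure disc_area S * \<bar>disc_mean f S - y\<bar> = \<bar>LINT z:S|disc_area. f z - y\<bar>"
    using pos by (metis abs_mult abs_of_pos)
  also have "\<dots> \<le> (LINT z:S|disc_area. \<bar>f z - y\<bar>)"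
    using set_integral_norm_bound[OF set_integrable_disc_area[OF
        Bochner_Integration.integrable_diff[OF f const] S], of y]
    by simp
  finally show ?thesis .
qed

text \<open>Exchanging y for the mean adds |mean - y|, which is itself at most the mean of |f - y|;
  hence the factor 2. This permits comparison with the value at a convenient point.\<close>

lemma mean_oscillation_le:
  assumes f: "integrable disc_area f" and S: "S \<in> sets disc_area" and pos: "0 < measure disc_area S"
    and le: "(\<integral>\<^sup>+z\<in>S. ennreal \<bar>f z - y\<bar> \<partial>disc_area) \<le> ennreal (T * measure disc_area S)"
    and T: "0 \<le> T"
  shows "(\<integral>\<^sup>+z\<in>S. ennreal \<bar>f z - disc_mean f S\<bar> \<partial>disc_area) / emeasure disc_area S \<le> ennreal (2 * T)"
proof -
  note const = finite_measure.integrable_const[OF finite_measure_disc_area]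
  define \<mu> where "\<mu> = disc_mean f S"
  have int: "integrable disc_area (\<lambda>z. f z - x)" for x
    using f const by (rule Bochner_Integration.integrable_diff)
  have "(LINT z:S|disc_area. \<bar>f z - y\<bar>) \<le> T * measure disc_area S"
    using le T pos set_nn_integral_abs_eq[OF int S] by (simp add: zero_le_mult_iff)
  moreover have "(LINT z:S|disc_area. \<bar>f z - \<mu>\<bar>) \<le>
      (LINT z:S|disc_area. \<bar>f z - y\<bar> + \<bar>\<mu> - y\<bar>)"
    by (intro set_integral_mono set_integrable_disc_area Bochner_Integration.integrable_add
        integrable_abs int const S) auto
  moreover have "(LINT z:S|disc_area. \<bar>f z - y\<bar> + \<bar>\<mu> - y\<bar>) =
      (LINT z:S|disc_area. \<bar>f z - y\<bar>) + (LINT z:S|disc_area. \<bar>\<mu> - y\<bar>)"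
    using int const S by (intro set_integral_add set_integrable_disc_area) auto
  moreover have "(LINT z:S|disc_area. \<bar>\<mu> - y\<bar>) = measure disc_area S * \<bar>\<mu> - y\<bar>"
    by (rule set_integral_const_disc_area[OF S])
  moreover have "measure disc_area S * \<bar>\<mu> - y\<bar> \<le> (LINT z:S|disc_area. \<bar>f z - y\<bar>)"
    unfolding \<mu>_def by (rule disc_mean_diff_const[OF f S pos])
  ultimately have "(LINT z:S|disc_area. \<bar>f z - \<mu>\<bar>) \<le> 2 * T * measure disc_area S"
    by linarith
  then have "(\<integral>\<^sup>+z\<in>S. ennreal \<bar>f z - \<mu>\<bar> \<partial>disc_area) \<le> ennreal (2 * T * measure disc_area S)"
    unfolding set_nn_integral_abs_eq[OF int S] by (rule ennreal_leI)
  then have "(\<integral>\<^sup>+z\<in>S. ennreal \<bar>f z - \<mu>\<bar> \<partial>disc_area) / emeasure disc_area S \<le>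
      ennreal (2 * T * measure disc_area S / measure disc_area S)"
    using pos T by (intro divide_le_ennreal) (auto simp: emeasure_disc_area_eq_measure)
  then show ?thesis
    using pos by (simp add: \<mu>_def)
qed

text \<open>The cap q <= 2 allows arbitrarily large r, for which the disc exceeds the unit disc and
  r^2 is no longer the order of the area.\<close>

lemma measure_ball_Int_ge:
  assumes "norm a < 1" "0 < q" "q \<le> 2" "q \<le> r"
  shows "q\<^sup>2 / 4 \<le> measure disc_area (ball a r \<inter> unit_disc)"
proof -
  have "ennreal (q\<^sup>2 / 4) \<le> emeasure disc_area (ball a q \<inter> unit_disc)"
    using assms by (intro emeasure_disc_area_ball_Int_ge)
  also have "\<dots> \<le> emeasure disc_area (ball a r \<inter> unit_disc)"
    using assms by (intro emeasure_mono ball_Int_unit_disc_in_sets) (auto simp: subset_ball)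
  finally show ?thesis
    by (simp add: emeasure_disc_area_eq_measure)
qed

text \<open>A disc of radius at most half the height of its centre has hyperbolic radius at most 1.
  A larger one lies, off the origin, in a Carleson square of comparable area, where beta <= exp beta
  has bounded mean. Radii above 2 give the same set as radius 2.\<close>

lemma bmo_norm_le_if_hyp_dist_Lipschitz:
  fixes v :: "complex \<Rightarrow> real"
  assumes \<epsilon>: "0 \<le> \<epsilon>"
    and lip: "\<And>z \<zeta>. norm z < 1 \<Longrightarrow> norm \<zeta> < 1 \<Longrightarrow> \<bar>v z - v \<zeta>\<bar> \<le> \<epsilon> * hyp_dist z \<zeta>"
  shows "bmo_norm v \<le> ennreal (2 ^ 24 * \<epsilon>)"
proof -
  have int: "integrable disc_area v"
    by (rule integrable_if_hyp_dist_Lipschitz[OF \<epsilon> lip])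
  have main: "(\<integral>\<^sup>+z\<in>ball a r \<inter> unit_disc. ennreal \<bar>v z - disc_mean v (ball a r \<inter> unit_disc)\<bar>
      \<partial>disc_area) / emeasure disc_area (ball a r \<inter> unit_disc) \<le> ennreal (2 ^ 24 * \<epsilon>)"
    if a: "norm a < 1" and r: "0 < r" "r \<le> 2" for a r
  proof -
    define S where "S = ball a r \<inter> unit_disc"
    have S: "S \<in> sets disc_area"
      unfolding S_def by (rule ball_Int_unit_disc_in_sets)
    have meas: "r\<^sup>2 / 4 \<le> measure disc_area S"
      unfolding S_def using a r by (intro measure_ball_Int_ge) auto
    moreover have "0 < r\<^sup>2 / 4"
      using r by simp
    ultimately have pos: "0 < measure disc_area S"
      by linarith
    have "\<exists>y. (\<integral>\<^sup>+z\<in>S. ennreal \<bar>v z - y\<bar> \<partial>disc_area) \<le> ennreal (2 ^ 23 * \<epsilon> * measure disc_area S)"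
    proof (cases "r \<le> (1 - norm a) / 2")
      case True
      have "(\<integral>\<^sup>+z\<in>S. ennreal \<bar>v z - v a\<bar> \<partial>disc_area) \<le>
          (\<integral>\<^sup>+z. ennreal (2 ^ 23 * \<epsilon>) * indicator S z \<partial>disc_area)"
      proof (rule nn_integral_mono)
        fix z
        have "\<bar>v z - v a\<bar> \<le> 2 ^ 23 * \<epsilon>" if "z \<in> S"
        proof -
          have z: "norm z < 1" "z \<in> ball a ((1 - norm a) / 2)"
            using that True by (auto simp: S_def)
          have "\<bar>v z - v a\<bar> \<le> \<epsilon> * hyp_dist a z"
            using lip[OF z(1) a] by (simp add: hyp_dist_commute[of z])
          also have "\<dots> \<le> \<epsilon> * 2 ^ 23"
            using hyp_dist_ball_half_le_1[OF a z(2)] \<epsilon> by (intro mult_left_mono) auto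
          finally show ?thesis
            by (simp add: mult.commute)
        qed
        then show "ennreal \<bar>v z - v a\<bar> * indicator S z \<le> ennreal (2 ^ 23 * \<epsilon>) * indicator S z"
          by (simp only: indicator_def) (simp add: ennreal_leI)
      qed
      also have "\<dots> = ennreal (2 ^ 23 * \<epsilon> * measure disc_area S)"
        using S \<epsilon> by (simp add: nn_integral_cmult_indicator emeasure_disc_area_eq_measure
            flip: ennreal_mult)
      finally show ?thesis ..
    next
      case False
      \<comment> \<open>With scale 2 r the covering square has arc length at most 80 r.\<close>
      then have d: "1 - norm a \<le> 2 * r"
        by simp
      obtain \<alpha> \<beta> where ab: "\<alpha> < \<beta>" "\<beta> \<le> \<alpha> + 2 * pi" "\<beta> - \<alpha> \<le> 40 * (2 * r)"
          "ball a (3 * (2 * r) / 2) \<inter> unit_disc - {0} \<subseteq> carleson_square (cis ` {\<alpha>..\<beta>})"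
        using ball_subset_carleson_square[OF a d] by blast
      let ?Q = "carleson_square (cis ` {\<alpha>..\<beta>})"
      have sub: "S - {0} \<subseteq> ?Q"
        using ab(4) r subset_ball[of r "3 * (2 * r) / 2" a] by (auto simp: S_def)
      obtain c where c: "norm c < 1"
        "(\<integral>\<^sup>+z\<in>?Q. ennreal (exp (hyp_dist z c)) \<partial>disc_area) \<le> ennreal (256 * (\<beta> - \<alpha>)\<^sup>2)"
        by (rule nn_integral_exp_hyp_dist_le[of \<alpha> \<beta> "{\<alpha>..\<beta>}"]) (use ab in auto)
      have [measurable]: "?Q \<in> sets disc_area" "(\<lambda>z. hyp_dist z c) \<in> borel_measurable disc_area"
        using carleson_square_in_sets[OF circle_arc_cis_Icc] ab measurable_hyp_dist_left c by auto
      have "(\<integral>\<^sup>+z\<in>S. ennreal \<bar>v z - v c\<bar> \<partial>disc_area) \<le>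
          (\<integral>\<^sup>+z. ennreal \<epsilon> * (ennreal (exp (hyp_dist z c)) * indicator ?Q z) \<partial>disc_area)"
      proof (rule nn_integral_mono_AE)
        show "AE z in disc_area. ennreal \<bar>v z - v c\<bar> * indicator S z \<le>
            ennreal \<epsilon> * (ennreal (exp (hyp_dist z c)) * indicator ?Q z)"
          using AE_disc_area_nonzero
        proof eventually_elim
          case (elim z)
          then have "\<bar>v z - v c\<bar> \<le> \<epsilon> * hyp_dist z c"
            using lip[of z c] c by simp
          also have "\<dots> \<le> \<epsilon> * exp (hyp_dist z c)"
            using \<epsilon> le_exp[of "hyp_dist z c"] by (intro mult_left_mono) auto
          finally have "ennreal \<bar>v z - v c\<bar> \<le> ennreal (\<epsilon> * exp (hyp_dist z c))"
            by (rule ennreal_leI)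
          moreover have "z \<in> ?Q" if "z \<in> S"
            using elim sub that by auto
          ultimately show ?case
            using \<epsilon> by (auto simp: indicator_def ennreal_mult)
        qed
      qed
      also have "\<dots> = ennreal \<epsilon> * (\<integral>\<^sup>+z\<in>?Q. ennreal (exp (hyp_dist z c)) \<partial>disc_area)"
        by (intro nn_integral_cmult) measurable
      also have "\<dots> \<le> ennreal \<epsilon> * ennreal (256 * (\<beta> - \<alpha>)\<^sup>2)"
        using c by (intro mult_left_mono) auto
      also have "\<dots> = ennreal (\<epsilon> * (256 * (\<beta> - \<alpha>)\<^sup>2))"
        using \<epsilon> by (simp add: ennreal_mult)
      also have "\<dots> \<le> ennreal (2 ^ 23 * \<epsilon> * measure disc_area S)"
      proof (rule ennreal_leI)
        \<comment> \<open>As r^2 / 4 is at most the area of S, the constant is 256 * 80^2 * 4 =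
          6553600, below 2^23.\<close>
        have "(\<beta> - \<alpha>)\<^sup>2 \<le> (80 * r)\<^sup>2"
          using ab by (intro power_mono) auto
        also have "\<dots> \<le> 25600 * measure disc_area S"
          using meas by (simp add: power_mult_distrib)
        finally have le: "256 * (\<beta> - \<alpha>)\<^sup>2 \<le> 2 ^ 23 * measure disc_area S"
          using pos by simp
        show "\<epsilon> * (256 * (\<beta> - \<alpha>)\<^sup>2) \<le> 2 ^ 23 * \<epsilon> * measure disc_area S"
          using mult_left_mono[OF le \<epsilon>] by (simp add: mult_ac)
      qed
      finally show ?thesis ..
    qed
    then obtain y where
      "(\<integral>\<^sup>+z\<in>S. ennreal \<bar>v z - y\<bar> \<partial>disc_area) \<le> ennreal (2 ^ 23 * \<epsilon> * measure disc_area S)"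
      by blast
    then have "(\<integral>\<^sup>+z\<in>S. ennreal \<bar>v z - disc_mean v S\<bar> \<partial>disc_area) / emeasure disc_area S \<le>
        ennreal (2 * (2 ^ 23 * \<epsilon>))"
      using \<epsilon> by (intro mean_oscillation_le[OF int S pos]) auto
    then show ?thesis
      by (simp add: S_def)
  qed
  have "(\<integral>\<^sup>+z\<in>ball a r \<inter> unit_disc. ennreal \<bar>v z - disc_mean v (ball a r \<inter> unit_disc)\<bar>
      \<partial>disc_area) / emeasure disc_area (ball a r \<inter> unit_disc) \<le> ennreal (2 ^ 24 * \<epsilon>)"
    if a: "norm a < 1" and r: "0 < r" for a r
  proof (cases "r \<le> 2")
    case True
    then show ?thesis
      using main a r by blast
  next
    case False
    have "unit_disc \<subseteq> ball a 2"
      using a by (simp add: ball_subset_ball_iff dist_norm)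
    then have "ball a r \<inter> unit_disc = ball a 2 \<inter> unit_disc"
      using False subset_ball[of 2 r a] by auto
    then show ?thesis
      using main[OF a, of 2] by simp
  qed
  then show ?thesis
    unfolding bmo_norm_def using int by (auto intro!: SUP_least)
qed

lemma bmo_norm_lessD:
  assumes "bmo_norm f < ennreal \<epsilon>"
  shows "integrable disc_area f"
    and "norm a < 1 \<Longrightarrow> 0 < r \<Longrightarrow>
      (LINT z:ball a r \<inter> unit_disc|disc_area. \<bar>f z - disc_mean f (ball a r \<inter> unit_disc)\<bar>) \<le>
        \<epsilon> * measure disc_area (ball a r \<inter> unit_disc)"
proof -
  show f: "integrable disc_area f"
    using assms by (auto simp: bmo_norm_def split: if_splits)
  assume a: "norm a < 1" and r: "0 < r"
  let ?S = "ball a r \<inter> unit_disc"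
  let ?I = "LINT z:?S|disc_area. \<bar>f z - disc_mean f ?S\<bar>"
  have int: "integrable disc_area (\<lambda>z. f z - disc_mean f ?S)"
    using f finite_measure.integrable_const[OF finite_measure_disc_area]
    by (rule Bochner_Integration.integrable_diff)
  have pos: "0 < measure disc_area ?S"
  proof -
    have "0 < (min r 2)\<^sup>2 / 4"
      using r by simp
    also have "\<dots> \<le> measure disc_area ?S"
      using a r by (intro measure_ball_Int_ge) auto
    finally show ?thesis .
  qed
  have I: "0 \<le> ?I"
    unfolding set_lebesgue_integral_def by (intro integral_nonneg_AE AE_I2) auto
  have "(\<integral>\<^sup>+z\<in>?S. ennreal \<bar>f z - disc_mean f ?S\<bar> \<partial>disc_area) / emeasure disc_area ?S \<le> bmo_norm f"
    unfolding bmo_norm_def using f a r by (auto intro!: SUP_upper2[of "(a, r)"])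
  then have "ennreal ?I / ennreal (measure disc_area ?S) < ennreal \<epsilon>"
    unfolding set_nn_integral_abs_eq[OF int ball_Int_unit_disc_in_sets] emeasure_disc_area_eq_measure
    using assms by (rule le_less_trans)
  then have "?I / measure disc_area ?S < \<epsilon>"
    using I pos by (simp add: divide_ennreal ennreal_less_iff)
  then show "?I \<le> \<epsilon> * measure disc_area ?S"
    using pos by (simp add: pos_divide_less_eq)
qed

section \<open>Change of means between nested discs\<close>

text \<open>The deviation of f from its mean over the larger set, integrated over the smaller one,
  is at most \<epsilon> s^2; dividing by the smaller area, at least q^2 / 4, gives the bound. Here q
  is a lower bound for the inner radius, capped at 2.\<close>

lemma disc_mean_nested_diff_le:
  assumes bmo: "bmo_norm f < ennreal \<epsilon>" and \<epsilon>: "0 \<le> \<epsilon>" and ab: "norm a < 1" "norm b < 1"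
    and q: "0 < q" "q \<le> 2" "q \<le> r" and s: "0 < s"
    and sub: "ball a r \<subseteq> ball b s"
  shows "\<bar>disc_mean f (ball a r \<inter> unit_disc) - disc_mean f (ball b s \<inter> unit_disc)\<bar> \<le>
    4 * \<epsilon> * (s / q)\<^sup>2"
proof -
  note const = finite_measure.integrable_const[OF finite_measure_disc_area]
  note f = bmo_norm_lessD(1)[OF bmo]
  define E F where "E = ball a r \<inter> unit_disc" and "F = ball b s \<inter> unit_disc"
  define y where "y = disc_mean f F"
  have sets: "E \<in> sets disc_area" "F \<in> sets disc_area"
    by (auto simp only: E_def F_def ball_Int_unit_disc_in_sets)
  have E: "q\<^sup>2 / 4 \<le> measure disc_area E"
    unfolding E_def using ab q by (intro measure_ball_Int_ge)
  moreover have q2: "0 < q\<^sup>2 / 4"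
    using q by simp
  ultimately have pos: "0 < measure disc_area E"
    by linarith
  have "emeasure disc_area F \<le> ennreal (s\<^sup>2)"
    using sets s by (intro emeasure_disc_area_le_ball[where z = b]) (auto simp: F_def)
  then have F: "measure disc_area F \<le> s\<^sup>2"
    by (simp add: emeasure_disc_area_eq_measure)
  have int: "integrable disc_area (\<lambda>z. \<bar>f z - y\<bar>)"
    using f const by (intro integrable_abs Bochner_Integration.integrable_diff)
  have "q\<^sup>2 / 4 * \<bar>disc_mean f E - y\<bar> \<le> measure disc_area E * \<bar>disc_mean f E - y\<bar>"
    using E by (intro mult_right_mono) auto
  also have "\<dots> \<le> (LINT z:E|disc_area. \<bar>f z - y\<bar>)"
    by (rule disc_mean_diff_const[OF f sets(1) pos])
  also have "\<dots> \<le> (LINT z:F|disc_area. \<bar>f z - y\<bar>)"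
    unfolding set_lebesgue_integral_def
    using set_integrable_disc_area[OF int sets(1)] set_integrable_disc_area[OF int sets(2)] sub
    by (intro integral_mono) (auto simp: set_integrable_def E_def F_def split: split_indicator)
  also have "\<dots> \<le> \<epsilon> * measure disc_area F"
    unfolding F_def y_def by (rule bmo_norm_lessD(2)[OF bmo ab(2) s])
  also have "\<dots> \<le> \<epsilon> * s\<^sup>2"
    using F \<epsilon> by (rule mult_left_mono)
  finally show ?thesis
    using q2 q by (simp add: E_def F_def y_def field_simps)
qed

text \<open>Each doubling costs 4 * 2^2 * \<epsilon>. The last radius may reach 4, since only the
  inner radius of each step has to be at most 2.\<close>

lemma disc_mean_doubling_le:
  assumes bmo: "bmo_norm f < ennreal \<epsilon>" and \<epsilon>: "0 \<le> \<epsilon>" and a: "norm a < 1" and r: "0 < r"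
    and n: "2 ^ n * r \<le> 4"
  shows "\<bar>disc_mean f (ball a r \<inter> unit_disc) - disc_mean f (ball a (2 ^ n * r) \<inter> unit_disc)\<bar> \<le>
    16 * \<epsilon> * real n"
  using n
proof (induction n)
  case (Suc n)
  have le: "2 ^ n * r \<le> 2"
    using Suc.prems by (simp add: mult.commute)
  have "\<bar>disc_mean f (ball a (2 ^ n * r) \<inter> unit_disc) -
      disc_mean f (ball a (2 ^ Suc n * r) \<inter> unit_disc)\<bar> \<le>
      4 * \<epsilon> * ((2 ^ Suc n * r) / (2 ^ n * r))\<^sup>2"
    using le r by (intro disc_mean_nested_diff_le[OF bmo \<epsilon> a a] subset_ball) auto
  also have "(2 ^ Suc n * r) / (2 ^ n * r) = 2"
    using r by simp
  finally have "\<bar>disc_mean f (ball a (2 ^ n * r) \<inter> unit_disc) -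
      disc_mean f (ball a (2 ^ Suc n * r) \<inter> unit_disc)\<bar> \<le> 16 * \<epsilon>"
    by simp
  moreover have "\<bar>disc_mean f (ball a r \<inter> unit_disc) -
      disc_mean f (ball a (2 ^ n * r) \<inter> unit_disc)\<bar> \<le> 16 * \<epsilon> * real n"
    using le by (intro Suc.IH) linarith
  moreover have "16 * \<epsilon> * real (Suc n) = 16 * \<epsilon> * real n + 16 * \<epsilon>"
    by (simp add: algebra_simps)
  ultimately show ?case
    by linarith
qed simp

lemma exists_doubling:
  fixes r d :: real
  assumes "0 < r" "r < d"
  obtains n :: nat where "d \<le> 2 ^ n * r" "2 ^ n * r < 2 * d"
proof -
  obtain m :: nat where "d / r < 2 ^ m"
    using real_arch_pow[of 2 "d / r"] by auto
  then have m: "d \<le> 2 ^ m * r"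
    using assms by (simp add: field_simps)
  define n where "n = (LEAST n. d \<le> 2 ^ n * r)"
  have n: "d \<le> 2 ^ n * r"
    unfolding n_def by (rule LeastI[of _ m]) (rule m)
  \<comment> \<open>By r < d; minimality applied to the predecessor then gives the upper
    bound.\<close>
  then have "n \<noteq> 0"
    using assms by (intro notI) simp
  then obtain k where k: "n = Suc k"
    using not0_implies_Suc by blast
  have "\<not> d \<le> 2 ^ k * r"
    using not_less_Least[of k "\<lambda>n. d \<le> 2 ^ n * r"] k by (auto simp: n_def)
  then show ?thesis
    using n k by (intro that[of n]) auto
qed

text \<open>The discs at z and \<zeta> are enlarged n and m times by the factor 2 until their radii
  lie between d and 2 d, and both are then compared with the disc of radius 3 d about z. The heights
  enter only through n + m, which is less than 6 + 4 beta.\<close>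

lemma growth_if_bmo_approximation:
  fixes u :: "complex \<Rightarrow> real"
  assumes C: "0 \<le> C" and osc: "\<And>z \<zeta>. norm z < 1 \<Longrightarrow> norm \<zeta> < 1 \<Longrightarrow>
      \<bar>u z - u \<zeta>\<bar> \<le> C * (1 + hyp_dist z \<zeta>)"
    and h: "h \<in> Linfty_disc" and bmo: "bmo_norm (\<lambda>z. u z - h z) < ennreal \<epsilon>" and \<epsilon>: "0 \<le> \<epsilon>"
  shows "\<exists>K>0. \<forall>z\<in>unit_disc. \<forall>\<zeta>\<in>unit_disc. \<bar>u z - u \<zeta>\<bar> \<le> K + 64 * \<epsilon> * hyp_dist z \<zeta>"
proof -
  obtain M where M: "AE z in disc_area. \<bar>h z\<bar> \<le> M"
    using h by (auto simp: Linfty_disc_def)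
  define f where "f z = u z - h z" for z
  have bmo': "bmo_norm f < ennreal \<epsilon>"
    using bmo by (simp add: f_def[abs_def])
  note f = bmo_norm_lessD(1)[OF bmo']
  define mean where "mean a r = disc_mean f (ball a r \<inter> unit_disc)" for a r
  have near: "\<bar>mean z ((1 - norm z) / 2) - u z\<bar> \<le> 2 * C + M" if z: "norm z < 1" for z
  proof -
    let ?S = "ball z ((1 - norm z) / 2) \<inter> unit_disc"
    have S: "?S \<in> sets disc_area"
      by (rule ball_Int_unit_disc_in_sets)
    have "0 < ((1 - norm z) / 2)\<^sup>2 / 4"
      using z by simp
    also have "\<dots> \<le> measure disc_area ?S"
      using z order_trans[OF _ norm_ge_zero[of z], of "- 3"] by (intro measure_ball_Int_ge) auto
    finally have pos: "0 < measure disc_area ?S" .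
    note const = finite_measure.integrable_const[OF finite_measure_disc_area]
    have int: "integrable disc_area (\<lambda>\<xi>. \<bar>f \<xi> - u z\<bar>)"
      using f const by (intro integrable_abs Bochner_Integration.integrable_diff)
    have "measure disc_area ?S * \<bar>mean z ((1 - norm z) / 2) - u z\<bar> \<le> (LINT \<xi>:?S|disc_area. \<bar>f \<xi> - u z\<bar>)"
      unfolding mean_def by (rule disc_mean_diff_const[OF f S pos])
    also have "\<dots> \<le> (LINT \<xi>:?S|disc_area. 2 * C + M)"
    proof (rule set_integral_mono_AE)
      show "AE \<xi>\<in>?S in disc_area. \<bar>f \<xi> - u z\<bar> \<le> 2 * C + M"
        using M
      proof eventually_elim
        case (elim \<xi>)
        show ?case
        proof
          assume \<xi>: "\<xi> \<in> ?S"
          then have "C * (1 + hyp_dist z \<xi>) \<le> C * 2"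
            using hyp_dist_ball_half_le_1[OF z, of \<xi>] C by (intro mult_left_mono) auto
          moreover have "\<bar>u z - u \<xi>\<bar> \<le> C * (1 + hyp_dist z \<xi>)"
            using osc z \<xi> by simp
          ultimately show "\<bar>f \<xi> - u z\<bar> \<le> 2 * C + M"
            using elim unfolding f_def by linarith
        qed
      qed
    qed (use int const S in \<open>auto intro: set_integrable_disc_area\<close>)
    also have "\<dots> = measure disc_area ?S * (2 * C + M)"
      by (rule set_integral_const_disc_area[OF S])
    finally show ?thesis
      using pos by (subst (asm) mult_le_cancel_left_pos) auto
  qed
  \<comment> \<open>168 = 16 * 6 + 2 * 36 and 64 = 16 * 4: the doublings and the two final
    comparisons. The term 4 C + 2 M pays for passing from point values to means at both
    ends.\<close>
  have far: "\<bar>u z - u \<zeta>\<bar> \<le> 4 * C + 2 * M + 168 * \<epsilon> + 64 * \<epsilon> * hyp_dist z \<zeta>"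
    if z: "norm z < 1" and \<zeta>: "norm \<zeta> < 1" for z \<zeta>
  proof -
    define d where "d = norm (1 - cnj z * \<zeta>)"
    define r s where "r = (1 - norm z) / 2" and "s = (1 - norm \<zeta>) / 2"
    have rs: "0 < r" "0 < s" and d: "0 < d" "d < 2"
      using z \<zeta> norm_one_minus_cnj_mult_pos norm_one_minus_cnj_mult_less_2
      by (auto simp: r_def s_def d_def)
    have "r < d" "s < d" and dist: "norm (z - \<zeta>) < d"
      using norm_one_minus_cnj_mult_ge[OF z \<zeta>] norm_diff_less_one_minus_cnj_mult[OF z \<zeta>] rs
      by (auto simp: d_def r_def s_def)
    obtain n where n: "d \<le> 2 ^ n * r" "2 ^ n * r < 2 * d"
      by (rule exists_doubling[OF rs(1) \<open>r < d\<close>])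
    obtain m where m: "d \<le> 2 ^ m * s" "2 ^ m * s < 2 * d"
      by (rule exists_doubling[OF rs(2) \<open>s < d\<close>])
    have 1: "\<bar>mean z r - mean z (2 ^ n * r)\<bar> \<le> 16 * \<epsilon> * real n"
      unfolding mean_def using n d by (intro disc_mean_doubling_le[OF bmo' \<epsilon> z rs(1)]) auto
    have 2: "\<bar>mean \<zeta> s - mean \<zeta> (2 ^ m * s)\<bar> \<le> 16 * \<epsilon> * real m"
      unfolding mean_def using m d by (intro disc_mean_doubling_le[OF bmo' \<epsilon> \<zeta> rs(2)]) auto
    \<comment> \<open>The lower bound q for the inner radius is d, admissible because d < 2.\<close>
    have "\<bar>mean z (2 ^ n * r) - mean z (3 * d)\<bar> \<le> 4 * \<epsilon> * (3 * d / d)\<^sup>2"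
      unfolding mean_def using n d
      by (intro disc_mean_nested_diff_le[OF bmo' \<epsilon> z z] subset_ball) auto
    then have 3: "\<bar>mean z (2 ^ n * r) - mean z (3 * d)\<bar> \<le> 36 * \<epsilon>"
      using d by simp
    have "dist \<zeta> z < d"
      using dist by (metis dist_commute dist_norm)
    then have "dist \<zeta> z + 2 ^ m * s \<le> 3 * d"
      using m by simp
    then have "ball \<zeta> (2 ^ m * s) \<subseteq> ball z (3 * d)"
      by (simp add: ball_subset_ball_iff)
    then have "\<bar>mean \<zeta> (2 ^ m * s) - mean z (3 * d)\<bar> \<le> 4 * \<epsilon> * (3 * d / d)\<^sup>2"
      unfolding mean_def using m d
      by (intro disc_mean_nested_diff_le[OF bmo' \<epsilon> \<zeta> z]) auto
    then have 4: "\<bar>mean \<zeta> (2 ^ m * s) - mean z (3 * d)\<bar> \<le> 36 * \<epsilon>"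
      using d by simp
    \<comment> \<open>Bounding n and m jointly brings in the product r s, which d^2 and exp (2 beta)
      control.\<close>
    have "(2 ^ n * r) * (2 ^ m * s) < (2 * d) * (2 * d)"
      by (rule mult_strict_mono') (use n m d rs in auto)
    also have "\<dots> = 4 * d\<^sup>2"
      by (simp add: power2_eq_square)
    also have "d\<^sup>2 \<le> 16 * exp (2 * hyp_dist z \<zeta>) * (r * s)"
      using norm_one_minus_cnj_mult_sq_le[OF z \<zeta>] by (simp add: d_def r_def s_def mult_ac)
    finally have "2 ^ (n + m) * (r * s) < 2 ^ 6 * exp (2 * hyp_dist z \<zeta>) * (r * s)"
      by (simp add: power_add mult_ac)
    then have "2 ^ (n + m) < 2 ^ 6 * exp (2 * hyp_dist z \<zeta>)"
      using rs by (subst (asm) mult_less_cancel_right_pos) auto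
    then have "ln (2 ^ (n + m)) < ln (2 ^ 6 * exp (2 * hyp_dist z \<zeta>))"
      by (subst ln_less_cancel_iff) auto
    then have "real (n + m) * ln 2 < 6 * ln 2 + 2 * hyp_dist z \<zeta>"
      using ln_realpow[of "2 :: real" 6] by (simp add: ln_mult ln_realpow)
    also have "2 * hyp_dist z \<zeta> \<le> (4 * hyp_dist z \<zeta>) * ln 2"
      using ln2_ge_two_thirds mult_left_mono[of "1 / 2" "ln 2" "4 * hyp_dist z \<zeta>"]
        hyp_dist_nonneg[OF z \<zeta>] by simp
    finally have "real (n + m) * ln 2 < (6 + 4 * hyp_dist z \<zeta>) * ln 2"
      by (simp add: algebra_simps)
    then have "real n + real m < 6 + 4 * hyp_dist z \<zeta>"
      by (subst (asm) mult_less_cancel_right_pos) auto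
    then have "16 * \<epsilon> * (real n + real m) \<le> 16 * \<epsilon> * (6 + 4 * hyp_dist z \<zeta>)"
      using \<epsilon> by (intro mult_left_mono) auto
    then have 5: "16 * \<epsilon> * real n + 16 * \<epsilon> * real m \<le> 96 * \<epsilon> + 64 * \<epsilon> * hyp_dist z \<zeta>"
      by (simp add: algebra_simps)
    have 6: "\<bar>mean z r - u z\<bar> \<le> 2 * C + M" "\<bar>mean \<zeta> s - u \<zeta>\<bar> \<le> 2 * C + M"
      using near[OF z] near[OF \<zeta>] by (simp_all only: r_def s_def)
    note bounds = 1 2 3 4 6
    show ?thesis
      using bounds[THEN abs_le_D1] bounds[THEN abs_le_D2] 5 by (intro abs_leI) linarith+
  qed
  \<comment> \<open>The maximum supplies positivity whatever the sign of M.\<close>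
  define K where "K = max 1 (4 * C + 2 * M + 168 * \<epsilon>)"
  have "0 < K"
    by (simp add: K_def)
  moreover have "\<bar>u z - u \<zeta>\<bar> \<le> K + 64 * \<epsilon> * hyp_dist z \<zeta>" if "z \<in> unit_disc" "\<zeta> \<in> unit_disc" for z \<zeta>
    using far[of z \<zeta>] that by (simp add: K_def)
  ultimately show ?thesis
    by blast
qed

theorem corollary1p2:
  fixes w :: "complex \<Rightarrow> real"
  assumes "weight w"
    and "bounded_hyperbolic_oscillation w"
  shows "((\<forall>l>0. B2_weight (\<lambda>z. w z powr l))
            \<longleftrightarrow> (\<forall>\<epsilon>>0. \<exists>h\<in>Linfty_disc. hlip_norm (\<lambda>z. ln (w z) - h z) < ennreal \<epsilon>))
       \<and> ((\<forall>\<epsilon>>0. \<exists>h\<in>Linfty_disc. hlip_norm (\<lambda>z. ln (w z) - h z) < ennreal \<epsilon>)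
            \<longleftrightarrow> (\<forall>\<epsilon>>0. \<exists>h\<in>Linfty_disc. bmo_norm (\<lambda>z. ln (w z) - h z) < ennreal \<epsilon>))
       \<and> ((\<forall>\<epsilon>>0. \<exists>h\<in>Linfty_disc. bmo_norm (\<lambda>z. ln (w z) - h z) < ennreal \<epsilon>)
            \<longleftrightarrow> (\<forall>\<epsilon>>0. \<exists>C>0. \<forall>z\<in>unit_disc. \<forall>\<zeta>\<in>unit_disc.
                  \<bar>ln (w z) - ln (w \<zeta>)\<bar> \<le> C + \<epsilon> * hyp_dist z \<zeta>))"
    (is "(?i \<longleftrightarrow> ?ii) \<and> (?ii \<longleftrightarrow> ?iii) \<and> (?iii \<longleftrightarrow> ?iv)")
proof -
  have pos: "0 < w z" if "norm z < 1" for z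
    using assms(1) that by (auto simp: weight_def)
  have [measurable]: "w \<in> borel_measurable disc_area"
    using assms(1) by (auto simp: weight_def)
  obtain C where "0 < C" and osc': "\<forall>z\<in>unit_disc. \<forall>\<zeta>\<in>unit_disc.
      \<bar>ln (w z) - ln (w \<zeta>)\<bar> \<le> C * (1 + hyp_dist z \<zeta>)"
    using assms(2) by (auto simp: bounded_hyperbolic_oscillation_def)
  then have C: "0 \<le> C"
    by simp
  have osc: "\<bar>ln (w z) - ln (w \<zeta>)\<bar> \<le> C * (1 + hyp_dist z \<zeta>)" if "norm z < 1" "norm \<zeta> < 1" for z \<zeta>
    using osc' that by simp
  have powr_diff: "\<bar>ln (w z powr l) - ln (w \<zeta> powr l)\<bar> = l * \<bar>ln (w z) - ln (w \<zeta>)\<bar>"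
    if "0 < l" "norm z < 1" "norm \<zeta> < 1" for l z \<zeta>
  proof -
    have "ln (w z powr l) - ln (w \<zeta> powr l) = l * (ln (w z) - ln (w \<zeta>))"
      using pos that by (simp add: ln_powr less_imp_neq[symmetric] right_diff_distrib)
    then show ?thesis
      using that by (simp add: abs_mult)
  qed
  have iv_i: ?i if iv: ?iv
  proof (intro allI impI)
    fix l :: real assume l: "0 < l"
    \<comment> \<open>The coefficient 1 / l becomes exactly 1 for \<open>w z powr l\<close>.\<close>
    then obtain K where K: "\<forall>z\<in>unit_disc. \<forall>\<zeta>\<in>unit_disc.
        \<bar>ln (w z) - ln (w \<zeta>)\<bar> \<le> K + 1 / l * hyp_dist z \<zeta>"
      using iv by (meson zero_less_divide_1_iff)
    show "B2_weight (\<lambda>z. w z powr l)"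
    proof (rule B2_weight_if_growth)
      fix z \<zeta> :: complex assume z: "norm z < 1" "norm \<zeta> < 1"
      then have "l * \<bar>ln (w z) - ln (w \<zeta>)\<bar> \<le> l * (K + 1 / l * hyp_dist z \<zeta>)"
        using K l by (intro mult_left_mono) auto
      then show "\<bar>ln (w z powr l) - ln (w \<zeta> powr l)\<bar> \<le> l * K + hyp_dist z \<zeta>"
        unfolding powr_diff[OF l z] using l by (simp add: distrib_left)
    qed (use pos in \<open>auto simp: less_imp_neq[symmetric]\<close>)
  qed
  have i_iv: ?iv if i: ?i
  proof (intro allI impI)
    fix \<epsilon> :: real assume \<epsilon>: "0 < \<epsilon>"
    \<comment> \<open>Dividing by l turns the fixed coefficient 4 into \<epsilon>.\<close>
    define l where "l = 4 / \<epsilon>"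
    have l: "0 < l"
      using \<epsilon> by (simp add: l_def)
    have "B2_char_sq (\<lambda>z. w z powr l) < \<infinity>"
      using i l by (simp add: B2_weight_def)
    moreover have "\<bar>ln (w z powr l) - ln (w \<zeta> powr l)\<bar> \<le> l * C * (1 + hyp_dist z \<zeta>)"
      if "norm z < 1" "norm \<zeta> < 1" for z \<zeta>
      using mult_left_mono[OF osc[OF that], of l] l
      unfolding powr_diff[OF l that] by (simp only: mult.assoc less_imp_le)
    moreover have "0 < w z powr l" if "norm z < 1" for z
      using pos[OF that] by simp
    moreover have "0 \<le> l * C"
      using l C by simp
    ultimately obtain K where K: "\<And>z \<zeta>. norm z < 1 \<Longrightarrow> norm \<zeta> < 1 \<Longrightarrow>
        \<bar>ln (w z powr l) - ln (w \<zeta> powr l)\<bar> \<le> K + 4 * hyp_dist z \<zeta>"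
      using growth_if_B2_char_sq_finite[of "\<lambda>z. w z powr l" "l * C"] by metis
    have "\<bar>ln (w z) - ln (w \<zeta>)\<bar> \<le> max 1 (K / l) + \<epsilon> * hyp_dist z \<zeta>"
      if "z \<in> unit_disc" "\<zeta> \<in> unit_disc" for z \<zeta>
    proof -
      have z: "norm z < 1" "norm \<zeta> < 1"
        using that by auto
      have "l * \<bar>ln (w z) - ln (w \<zeta>)\<bar> \<le> K + 4 * hyp_dist z \<zeta>"
        using K[OF z] unfolding powr_diff[OF l z] .
      then have "\<bar>ln (w z) - ln (w \<zeta>)\<bar> \<le> K / l + 4 / l * hyp_dist z \<zeta>"
        using l by (simp add: field_simps)
      also have "4 / l = \<epsilon>"
        using \<epsilon> by (simp add: l_def)
      finally show ?thesis
        by simp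
    qed
    then show "\<exists>C>0. \<forall>z\<in>unit_disc. \<forall>\<zeta>\<in>unit_disc.
        \<bar>ln (w z) - ln (w \<zeta>)\<bar> \<le> C + \<epsilon> * hyp_dist z \<zeta>"
      by (intro exI[of _ "max 1 (K / l)"]) auto
  qed
  have iv_ii: ?ii if iv: ?iv
  proof (intro allI impI)
    fix \<epsilon> :: real assume \<epsilon>: "0 < \<epsilon>"
    \<comment> \<open>Half of \<epsilon>, since the approximation gives a weak inequality and a
      strict one is required.\<close>
    then obtain K where K: "\<forall>z\<in>unit_disc. \<forall>\<zeta>\<in>unit_disc.
        \<bar>ln (w z) - ln (w \<zeta>)\<bar> \<le> K + \<epsilon> / 2 * hyp_dist z \<zeta>"
      using iv by (meson half_gt_zero)
    have "\<exists>h\<in>Linfty_disc. hlip_norm (\<lambda>z. ln (w z) - h z) \<le> ennreal (\<epsilon> / 2)"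
      using K \<epsilon> by (intro hlip_approximation[where C = K]) auto
    then show "\<exists>h\<in>Linfty_disc. hlip_norm (\<lambda>z. ln (w z) - h z) < ennreal \<epsilon>"
      using \<epsilon> by (metis ennreal_lessI field_sum_of_halves half_gt_zero le_less_trans
          less_add_same_cancel1)
  qed
  have ii_iii: ?iii if ii: ?ii
  proof (intro allI impI)
    fix \<epsilon> :: real assume \<epsilon>: "0 < \<epsilon>"
    \<comment> \<open>The exponent 25, one more than in the BMO bound, leaves \<epsilon> / 2 and
      hence strictness.\<close>
    then obtain h where h: "h \<in> Linfty_disc"
        "hlip_norm (\<lambda>z. ln (w z) - h z) < ennreal (\<epsilon> / 2 ^ 25)"
      using ii by (meson divide_pos_pos zero_less_numeral zero_less_power)
    have "bmo_norm (\<lambda>z. ln (w z) - h z) \<le> ennreal (2 ^ 24 * (\<epsilon> / 2 ^ 25))"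
      using \<epsilon> by (intro bmo_norm_le_if_hyp_dist_Lipschitz hlip_norm_lessD[OF h(2)]) auto
    also have "\<dots> < ennreal \<epsilon>"
      using \<epsilon> by (intro ennreal_lessI) auto
    finally show "\<exists>h\<in>Linfty_disc. bmo_norm (\<lambda>z. ln (w z) - h z) < ennreal \<epsilon>"
      using h by blast
  qed
  have iii_iv: ?iv if iii: ?iii
  proof (intro allI impI)
    fix \<epsilon> :: real assume \<epsilon>: "0 < \<epsilon>"
    then obtain h where h: "h \<in> Linfty_disc"
        "bmo_norm (\<lambda>z. ln (w z) - h z) < ennreal (\<epsilon> / 64)"
      using iii by (meson divide_pos_pos zero_less_numeral)
    show "\<exists>C>0. \<forall>z\<in>unit_disc. \<forall>\<zeta>\<in>unit_disc.
        \<bar>ln (w z) - ln (w \<zeta>)\<bar> \<le> C + \<epsilon> * hyp_dist z \<zeta>"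
      using growth_if_bmo_approximation[OF C osc h] \<epsilon> by simp
  qed
  have ii_iv: ?iv if ii: ?ii
    using ii_iii[OF ii] by (rule iii_iv)
  show ?thesis
    using iv_i i_iv iv_ii ii_iii iii_iv by blast
qed

end
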